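(* Let $P$ be the transition operator of a PCA on $\Omega_S=\{-1,+1\}^{\mathbb{Z}^d}$ with coefficients $(r_A)$, let $\kappa=\big(\sum_{A\Subset\mathbb{Z}^d}|A|\,|r_A|\big)^2$, assumed finite, and let $\mu$ be a probability measure on $\Omega_S$ satisfying $\mathrm{GCB}(C)$ for some $C>0$. Let $c$ be a constant such that every product probability measure on $\Omega_S$ satisfies $\mathrm{GCB}(c)$; in particular one can choose $c=1/4$. Then the following hold. (a) $\mu P$ satisfies $\mathrm{GCB}(C_1)$ with $C_1=c+C\kappa$. (b) As a consequence, for all $n\in\mathbb{N}$, $\mu P^n$ satisfies $\mathrm{GCB}(C_n)$ with $$C_n=\begin{cases} c\,\dfrac{1-\kappa^n}{1-\kappa}+C\kappa^n & \text{if } \kappa\neq 1,\\[2mm] c\,n+C & \text{if } \kappa=1.\end{cases}$$ (c) If $\kappa<1$, then $\mu P^n\to\nu$ weakly as $n\to\infty$, where $\nu$ is the unique stationary probability measure, and $\nu$ satisfies $\mathrm{GCB}(C_\infty)$ with $C_\infty=\dfrac{c}{1-\kappa}$. (d) If the PCA is non-interacting, i.e. for every $x\in\mathbb{Z}^d$ the quantity $h_x(\sigma)$ depends on $\sigma$ only through $\sigma_x$, then GCB is conserved (if $\mu$ satisfies GCB then so does $\mu P^n$ for every $n$), and the unique stationary measure is a product measure, hence also satisfies GCB.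
   Context: $\mathbb{N}=\{0,1,2,\dots\}$. $A\Subset\mathbb{Z}^d$ means $A$ is a finite subset of $\mathbb{Z}^d$. $\Omega_S=\{-1,+1\}^{\mathbb{Z}^d}$ has the product topology and Borel $\sigma$-algebra. PCA: real coefficients $(r_A)_{A\Subset\mathbb{Z}^d}$ with $\sum_A|r_A|<\infty$ are given; for $\eta\in\Omega_S$ and $x\in\mathbb{Z}^d$ set $h_x(\eta)=\sum_{A\Subset\mathbb{Z}^d} r_A\,\eta_{A+x}$, where $\eta_B=\prod_{y\in B}\eta_y$, and assume $|h_x(\eta)|\le 1$ for all $\eta$ and $x$. Given $\eta$, $p(d\sigma|\eta)$ is the product probability measure on $\Omega_S$ with marginals $p(\sigma_x=s\,|\,\eta)=\frac12(1+s\,h_x(\eta))$, $s\in\{-1,+1\}$. The transition operator is $Pf(\eta)=\int f(\sigma)\,p(d\sigma|\eta)$ on continuous $f:\Omega_S\to\mathbb{R}$, and acts on probability measures by $\mu P(d\sigma)=\int p(d\sigma|\eta)\,\mu(d\eta)$. A probability measure $\mu$ is stationary if $\mu P=\mu$. GCB: a function is local if it depends on finitely many coordinates. For $f:\Omega_S\to\mathbb{R}$, $\delta_x f=\sup_{\sigma}\big(f(\sigma^{(x)})-f(\sigma)\big)$, where $\sigma^{(x)}$ is $\sigma$ with the spin at $x$ flipped, and $\|\delta f\|_2^2=\sum_{x\in\mathbb{Z}^d}(\delta_x f)^2$. A probability measure $\mu$ on $\Omega_S$ satisfies $\mathrm{GCB}(C)$ if for every local $f:\Omega_S\to\mathbb{R}$,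 $$\log\int e^{f-\int f\,d\mu}\,d\mu\le\frac{C}{2}\|\delta f\|_2^2 .$$ "Satisfies GCB" means it satisfies $\mathrm{GCB}(C)$ for some finite $C$.
   Formalization: In (d), existence of the unique stationary measure is claimed only for κ≠1: for κ=1 a non-interacting PCA is the identity or the global spin flip, which has many stationary measures; whenever a unique stationary measure exists it is shown to be a product measure satisfying GCB. *)

theory Defs
  imports "HOL-Probability.Probability"
begin

definition Omega_S :: "(int ^ 'd::finite \<Rightarrow> real) set" where
  "Omega_S = {\<sigma>. \<forall>x. \<sigma> x \<in> {-1, 1}}"

text \<open>\<^const>\<open>borel\<close> below is generated by the product topology on functions, so restricting it to
  \<^const>\<open>Omega_S\<close> gives the Borel sets of the (subspace) product topology on configurations.\<close>

definition prob_measures_on_Omega :: "(int ^ 'd::finite \<Rightarrow> real) measure set" where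
  "prob_measures_on_Omega = {\<mu>. prob_space \<mu> \<and> sets \<mu> = sets (restrict_space borel Omega_S)}"

definition product_measure :: "(int ^ 'd::finite \<Rightarrow> real) measure \<Rightarrow> bool" where
  "product_measure \<mu> \<longleftrightarrow>
     (\<exists>M. (\<forall>x. prob_space (M x) \<and> sets (M x) = sets (count_space {-1, 1})) \<and> \<mu> = PiM UNIV M)"

definition weakly_converges ::
    "(nat \<Rightarrow> (int ^ 'd::finite \<Rightarrow> real) measure) \<Rightarrow> (int ^ 'd \<Rightarrow> real) measure \<Rightarrow> bool" where
  "weakly_converges \<mu>s \<nu> \<longleftrightarrow>
     (\<forall>f :: (int ^ 'd \<Rightarrow> real) \<Rightarrow> real. continuous_on Omega_S f \<longrightarrow>
        (\<lambda>n. \<integral>\<sigma>. f \<sigma> \<partial>(\<mu>s n)) \<longlonglongrightarrow> (\<integral>\<sigma>. f \<sigma> \<partial>\<nu>))"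

lemma Omega_S_eq_PiE: "Omega_S = (\<Pi>\<^sub>E x\<in>UNIV. {-1, 1})"
  by (auto simp: Omega_S_def)

text \<open>By the next lemma, \<open>product_measure\<close>, built with \<^const>\<open>PiM\<close>, uses the same measurable space as
  \<^const>\<open>prob_measures_on_Omega\<close>.\<close>

lemma sets_Omega_S_eq_PiM:
  "sets (restrict_space borel Omega_S) =
   sets (PiM UNIV (\<lambda>_ :: int ^ 'd::finite. count_space {-1, 1 :: real}))"
  (is "sets ?R = sets ?P")
proof -
  have spR: "space ?R = (Omega_S :: (int ^ 'd \<Rightarrow> real) set)"
    by (simp add: space_restrict_space)
  have spP: "space ?P = (Omega_S :: (int ^ 'd \<Rightarrow> real) set)"
    by (simp add: space_PiM Omega_S_eq_PiE)
  have "(\<lambda>\<sigma>. \<sigma>) \<in> measurable ?P (PiM UNIV (\<lambda>_. borel))"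
  proof (rule measurable_PiM_single')
    fix x :: "int ^ 'd"
    have "(\<lambda>\<sigma>. \<sigma> x) \<in> measurable ?P (count_space {-1, 1})"
      by (rule measurable_component_singleton) simp
    moreover have "(\<lambda>s. s) \<in> measurable (count_space {-1, 1 :: real}) borel"
      by simp
    ultimately show "(\<lambda>\<sigma>. \<sigma> x) \<in> measurable ?P borel"
      using measurable_compose by blast
  qed auto
  hence "(\<lambda>\<sigma>. \<sigma>) \<in> measurable ?P borel"
    by (simp cong: measurable_cong_sets add: sets_PiM_equal_borel)
  hence 1: "(\<lambda>\<sigma>. \<sigma>) \<in> measurable ?P ?R"
    by (intro measurable_restrict_space2) (simp_all add: spP)
  have 2: "(\<lambda>\<sigma>. \<sigma>) \<in> measurable ?R ?P"
  proof (rule measurable_PiM_single')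
    fix x :: "int ^ 'd"
    have m: "(\<lambda>\<sigma>. \<sigma> x) \<in> measurable ?R borel"
      by (intro measurable_restrict_space1 measurable_product_coordinates)
    have "(\<lambda>\<sigma>. \<sigma> x) -` {s} \<inter> space ?R \<in> sets ?R" for s
      using measurable_sets[OF m, of "{s}"] by simp
    thus "(\<lambda>\<sigma>. \<sigma> x) \<in> measurable ?R (count_space {-1, 1})"
      by (subst measurable_count_space_eq2) (auto simp: spR Omega_S_def)
  qed (auto simp: spR Omega_S_def)
  show ?thesis
  proof (intro equalityI subsetI)
    fix A assume A: "A \<in> sets ?R"
    hence "A \<subseteq> Omega_S" using sets.sets_into_space spR by metis
    thus "A \<in> sets ?P" using measurable_sets[OF 1 A] by (simp add: spP Int_absorb2)
  next
    fix A assume A: "A \<in> sets ?P"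
    hence "A \<subseteq> Omega_S" using sets.sets_into_space spP by metis
    thus "A \<in> sets ?R" using measurable_sets[OF 2 A] by (simp add: spR Int_absorb2)
  qed
qed

definition pca_h :: "((int ^ 'd::finite) set \<Rightarrow> real) \<Rightarrow> int ^ 'd \<Rightarrow> (int ^ 'd \<Rightarrow> real) \<Rightarrow> real" where
  "pca_h r x \<eta> = (\<Sum>\<^sub>\<infinity>A\<in>{A. finite A}. r A * (\<Prod>y\<in>(\<lambda>a. a + x) ` A. \<eta> y))"

definition pca :: "((int ^ 'd::finite) set \<Rightarrow> real) \<Rightarrow> bool" where
  "pca r \<longleftrightarrow>
     (\<lambda>A. \<bar>r A\<bar>) summable_on {A. finite A} \<and>
     (\<forall>\<eta>\<in>Omega_S. \<forall>x. \<bar>pca_h r x \<eta>\<bar> \<le> 1)"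

definition pca_kernel ::
    "((int ^ 'd::finite) set \<Rightarrow> real) \<Rightarrow> (int ^ 'd \<Rightarrow> real) \<Rightarrow> (int ^ 'd \<Rightarrow> real) measure" where
  "pca_kernel r \<eta> =
     PiM UNIV (\<lambda>x. point_measure {-1, 1} (\<lambda>s. ennreal (1/2 * (1 + s * pca_h r x \<eta>))))"

text \<open>The Giry-monad bind is $\mu P(d\sigma) = \int p(d\sigma|\eta)\,\mu(d\eta)$; accordingly
  $\mu P^n$ is \<open>(pca_push r ^^ n) \<mu>\<close>.\<close>

definition pca_push ::
    "((int ^ 'd::finite) set \<Rightarrow> real) \<Rightarrow> (int ^ 'd \<Rightarrow> real) measure \<Rightarrow> (int ^ 'd \<Rightarrow> real) measure" where
  "pca_push r \<mu> = \<mu> \<bind> pca_kernel r"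

definition stationary ::
    "((int ^ 'd::finite) set \<Rightarrow> real) \<Rightarrow> (int ^ 'd \<Rightarrow> real) measure \<Rightarrow> bool" where
  "stationary r \<mu> \<longleftrightarrow> \<mu> \<in> prob_measures_on_Omega \<and> pca_push r \<mu> = \<mu>"

definition unique_stationary ::
    "((int ^ 'd::finite) set \<Rightarrow> real) \<Rightarrow> (int ^ 'd \<Rightarrow> real) measure \<Rightarrow> bool" where
  "unique_stationary r \<nu> \<longleftrightarrow> stationary r \<nu> \<and> (\<forall>\<nu>'. stationary r \<nu>' \<longrightarrow> \<nu>' = \<nu>)"

definition non_interacting :: "((int ^ 'd::finite) set \<Rightarrow> real) \<Rightarrow> bool" where
  "non_interacting r \<longleftrightarrow>
     (\<forall>x. \<forall>\<sigma>\<in>Omega_S. \<forall>\<sigma>'\<in>Omega_S. \<sigma> x = \<sigma>' x \<longrightarrow> pca_h r x \<sigma> = pca_h r x \<sigma>')"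

text \<open>Functions on $\Omega_S$ are represented by functions on all of \<^typ>\<open>int ^ 'd \<Rightarrow> real\<close>; only
  their values on \<^const>\<open>Omega_S\<close> matter in what follows.\<close>

definition local_fun :: "((int ^ 'd::finite \<Rightarrow> real) \<Rightarrow> real) \<Rightarrow> bool" where
  "local_fun f \<longleftrightarrow>
     (\<exists>\<Lambda>. finite \<Lambda> \<and>
       (\<forall>\<sigma>\<in>Omega_S. \<forall>\<sigma>'\<in>Omega_S. (\<forall>x\<in>\<Lambda>. \<sigma> x = \<sigma>' x) \<longrightarrow> f \<sigma> = f \<sigma>'))"

definition osc :: "int ^ 'd::finite \<Rightarrow> ((int ^ 'd \<Rightarrow> real) \<Rightarrow> real) \<Rightarrow> real" where
  "osc x f = (SUP \<sigma>\<in>Omega_S. f (\<sigma>(x := - \<sigma> x)) - f \<sigma>)"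

definition GCB :: "real \<Rightarrow> (int ^ 'd::finite \<Rightarrow> real) measure \<Rightarrow> bool" where
  "GCB C \<mu> \<longleftrightarrow> \<mu> \<in> prob_measures_on_Omega \<and>
     (\<forall>f. local_fun f \<longrightarrow>
        ln (\<integral>\<sigma>. exp (f \<sigma> - (\<integral>\<sigma>'. f \<sigma>' \<partial>\<mu>)) \<partial>\<mu>) \<le> C / 2 * (\<Sum>\<^sub>\<infinity>x. (osc x f)\<^sup>2))"

definition satisfies_GCB :: "(int ^ 'd::finite \<Rightarrow> real) measure \<Rightarrow> bool" where
  "satisfies_GCB \<mu> \<longleftrightarrow> (\<exists>C. GCB C \<mu>)"

end

theory Submission
  imports Defs
begin

text \<open>
  Flipping the spin at \<open>y\<close> changes \<open>h\<^sub>x\<close> by at most twice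
  \<open>a (y - x)\<close>, where \<open>a z\<close> is the sum of \<open>\<bar>r A\<bar>\<close> over the \<open>A\<close> containing \<open>z\<close>. Replacing the
  marginals of a product measure one site at a time therefore bounds the oscillations of \<open>P f\<close> by
  the convolution of \<open>a\<close> with those of \<open>f\<close>, and since \<open>a\<close> has total mass \<open>sqrt \<kappa>\<close>, Young's
  inequality contracts the squared l2 norm of the oscillations by \<open>\<kappa>\<close> and the l1 norm by
  \<open>sqrt \<kappa>\<close>. The l2 bound, applied after integrating \<open>exp f\<close> against the product measure
  \<open>p(d\<sigma>|\<eta>)\<close>, propagates GCB; as \<open>P f\<close> is no longer local, GCB is first extended to continuous
  functions by approximation. The l1 bound makes the differences of the integrals of a local
  function under two evolved measures decay like the powers of \<open>sqrt \<kappa>\<close>, which gives convergence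
  and uniqueness of the stationary measure. In the non-interacting case \<open>h\<^sub>0\<close> depends on one spin
  only, so by orthogonality of the Walsh functions under the uniform measure \<open>r A = 0\<close> unless
  \<open>A \<subseteq> {0}\<close>, whence \<open>\<kappa> = (r {0})\<^sup>2 \<le> 1\<close>.
\<close>

section \<open>Local and continuous functions\<close>

text \<open>Two norms occur because they answer different questions. GCB measures oscillations in
  l2, but an l2 bound does not control the range of a function: for the average of n spins it tends
  to 0 while the range stays 2. Only the l1 sum dominates the difference of the integrals of f under
  two arbitrary measures. One step of the dynamics destroys locality, because each field may see
  infinitely many spins. Uniform approximation by local functions alone would not help, since the
  sup norm says nothing about sums of oscillations. Freezing the spins outside a finite set at +1
  approximates uniformly and increases no oscillation. For the same reason every bound on
  \<open>P f\<close> is a bound on all finite partial sums, with \<open>S\<close> in the role of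
  sqrt \<kappa>. The constant 1/4 is Hoeffding's: a centred two-point variable of range D has
  log-Laplace transform at most D^2/8, and GCB carries a factor 1/2. The mass of \<open>a\<close> is
  a double count, each \<open>A\<close> being met once per element.\<close>

type_synonym 'd config = "int ^ 'd \<Rightarrow> real"

text \<open>The support is explicit, where \<open>local_fun\<close> hides it in an existential: the
  bounds below are sums over \<open>\<Lambda>\<close>, which need not be the smallest
  support.\<close>

definition depends_on :: "(int ^ 'd::finite) set \<Rightarrow> ('d config \<Rightarrow> real) \<Rightarrow> bool" where
  "depends_on \<Lambda> f \<longleftrightarrow>
     (\<forall>\<sigma>\<in>Omega_S. \<forall>\<sigma>'\<in>Omega_S. (\<forall>x\<in>\<Lambda>. \<sigma> x = \<sigma>' x) \<longrightarrow> f \<sigma> = f \<sigma>')"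

text \<open>Boundary condition +1 outside \<open>\<Lambda>\<close>. Composition with it makes any
  function depend on \<open>\<Lambda>\<close> only, without leaving \<open>Omega_S\<close>.\<close>

definition clamp :: "(int ^ 'd::finite) set \<Rightarrow> 'd config \<Rightarrow> 'd config" where
  "clamp \<Lambda> \<sigma> = (\<lambda>x. if x \<in> \<Lambda> then \<sigma> x else 1)"

lemma local_fun_iff_depends_on: "local_fun f \<longleftrightarrow> (\<exists>\<Lambda>. finite \<Lambda> \<and> depends_on \<Lambda> f)"
  by (simp add: local_fun_def depends_on_def)

lemma depends_onD:
  "depends_on \<Lambda> f \<Longrightarrow> \<sigma> \<in> Omega_S \<Longrightarrow> \<sigma>' \<in> Omega_S \<Longrightarrow> (\<And>x. x \<in> \<Lambda> \<Longrightarrow> \<sigma> x = \<sigma>' x) \<Longrightarrow> f \<sigma> = f \<sigma>'"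
  unfolding depends_on_def by blast

lemma depends_on_mono: "depends_on \<Lambda> f \<Longrightarrow> \<Lambda> \<subseteq> \<Lambda>' \<Longrightarrow> depends_on \<Lambda>' f"
  unfolding depends_on_def by blast

lemma depends_on_compose: "depends_on \<Lambda> f \<Longrightarrow> depends_on \<Lambda> (\<lambda>\<sigma>. h (f \<sigma>))"
  unfolding depends_on_def by (intro ballI impI arg_cong[of _ _ h]) blast

lemma one_in_Omega_S: "(\<lambda>_. 1) \<in> Omega_S"
  by (simp add: Omega_S_def)

lemma Omega_S_not_empty: "Omega_S \<noteq> {}"
  using one_in_Omega_S by blast

lemma Omega_S_upd: "\<sigma> \<in> Omega_S \<Longrightarrow> s \<in> {-1, 1} \<Longrightarrow> \<sigma>(x := s) \<in> Omega_S"
  by (auto simp: Omega_S_def)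

lemma Omega_S_flip: "\<sigma> \<in> Omega_S \<Longrightarrow> \<sigma>(x := - \<sigma> x) \<in> Omega_S"
  by (rule Omega_S_upd) (auto simp: Omega_S_def)

lemma Omega_S_cases: "\<sigma> \<in> Omega_S \<Longrightarrow> \<sigma> x = 1 \<or> \<sigma> x = -1"
  by (auto simp: Omega_S_def)

lemma abs_Omega_S: "\<sigma> \<in> Omega_S \<Longrightarrow> \<bar>\<sigma> x\<bar> = 1"
  using Omega_S_cases[of \<sigma> x] by auto

lemma clamp_in_Omega_S: "\<sigma> \<in> Omega_S \<Longrightarrow> clamp \<Lambda> \<sigma> \<in> Omega_S"
  by (auto simp: Omega_S_def clamp_def)

lemma depends_on_clamp: "depends_on \<Lambda> (\<lambda>\<sigma>. f (clamp \<Lambda> \<sigma>))"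
  unfolding depends_on_def
proof (intro ballI impI)
  fix \<sigma> \<sigma>' :: "'a config" assume "\<forall>x\<in>\<Lambda>. \<sigma> x = \<sigma>' x"
  hence "clamp \<Lambda> \<sigma> = clamp \<Lambda> \<sigma>'"
    by (auto simp: clamp_def)
  thus "f (clamp \<Lambda> \<sigma>) = f (clamp \<Lambda> \<sigma>')" by simp
qed

lemma compact_Omega_S: "compact (Omega_S :: 'd::finite config set)"
proof -
  have "compactin (product_topology (\<lambda>_. euclidean) UNIV)
          (\<Pi>\<^sub>E x\<in>(UNIV :: (int ^ 'd) set). {-1, 1 :: real})"
    by (subst compactin_PiE) (simp add: finite_imp_compactin)
  thus ?thesis
    by (simp add: Omega_S_eq_PiE euclidean_product_topology)
qed

text \<open>Compactness gives uniform continuity for the weighted metric on functions of countably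
  many coordinates, in which the coordinates beyond the first ones in the enumeration
  \<open>from_nat\<close> contribute at most \<open>(1/2) ^ N\<close>.\<close>

lemma continuous_on_Omega_S_quasilocal:
  fixes f :: "'d::finite config \<Rightarrow> real"
  assumes f: "continuous_on Omega_S f" and e: "e > 0"
  obtains \<Lambda> where "finite \<Lambda>"
    "\<And>\<sigma> \<sigma>'. \<sigma> \<in> Omega_S \<Longrightarrow> \<sigma>' \<in> Omega_S \<Longrightarrow> (\<And>x. x \<in> \<Lambda> \<Longrightarrow> \<sigma> x = \<sigma>' x) \<Longrightarrow> \<bar>f \<sigma> - f \<sigma>'\<bar> < e"
proof -
  have "uniformly_continuous_on Omega_S f"
    using f compact_Omega_S by (rule compact_uniformly_continuous)
  then obtain \<delta> where \<delta>: "\<delta> > 0"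
    "\<And>\<sigma> \<sigma>'. \<sigma> \<in> Omega_S \<Longrightarrow> \<sigma>' \<in> Omega_S \<Longrightarrow> dist \<sigma>' \<sigma> < \<delta> \<Longrightarrow> dist (f \<sigma>') (f \<sigma>) < e"
    using e unfolding uniformly_continuous_on_def by metis
  obtain N where N: "(1/2 :: real) ^ N < \<delta>"
    using real_arch_pow_inv[of \<delta> "1/2"] \<delta>(1) by auto
  define \<Lambda> :: "(int ^ 'd) set" where "\<Lambda> = from_nat ` {..N}"
  have "\<bar>f \<sigma> - f \<sigma>'\<bar> < e"
    if "\<sigma> \<in> Omega_S" "\<sigma>' \<in> Omega_S" and eq: "\<And>x. x \<in> \<Lambda> \<Longrightarrow> \<sigma> x = \<sigma>' x" for \<sigma> \<sigma>'
  proof -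
    have "{dist (\<sigma> (from_nat n)) (\<sigma>' (from_nat n)) |n. n \<le> N} = {0}"
      using eq by (auto simp: \<Lambda>_def intro!: exI[of _ 0])
    with dist_fun_le_dist_first_terms[of \<sigma> \<sigma>' N] N have "dist \<sigma> \<sigma>' < \<delta>" by simp
    with \<delta>(2) that show ?thesis by (simp add: dist_real_def)
  qed
  moreover have "finite \<Lambda>" by (simp add: \<Lambda>_def)
  ultimately show thesis using that by blast
qed

lemma depends_on_continuous_on:
  fixes f :: "'d::finite config \<Rightarrow> real"
  assumes fin: "finite \<Lambda>" and f: "depends_on \<Lambda> f"
  shows "continuous_on Omega_S f"
  unfolding continuous_on_topological
proof (intro ballI allI impI)
  fix \<sigma> :: "'d config" and B assume \<sigma>: "\<sigma> \<in> Omega_S" and B: "open B" "f \<sigma> \<in> B"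
  \<comment> \<open>Distinct spins are at distance 2, so balls of radius 1 fix every coordinate in
    \<open>\<Lambda>\<close>.\<close>
  define A where "A = (\<Inter>x\<in>\<Lambda>. (\<lambda>\<eta> :: 'd config. \<eta> x) -` ball (\<sigma> x) 1)"
  have "open A"
    unfolding A_def using fin by (intro open_INT ballI open_vimage continuous_on_product_coordinates) auto
  moreover have "\<sigma> \<in> A" by (simp add: A_def)
  moreover have "f \<eta> \<in> B" if \<eta>: "\<eta> \<in> Omega_S" "\<eta> \<in> A" for \<eta>
  proof -
    have "\<sigma> x = \<eta> x" if "x \<in> \<Lambda>" for x
    proof -
      have "\<bar>\<sigma> x - \<eta> x\<bar> < 1" using \<eta> that by (auto simp: A_def dist_real_def)
      thus ?thesis using Omega_S_cases[OF \<sigma>, of x] Omega_S_cases[OF \<eta>(1), of x] by auto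
    qed
    hence "f \<sigma> = f \<eta>" by (rule depends_onD[OF f \<sigma> \<eta>(1)])
    thus ?thesis using B by simp
  qed
  ultimately show "\<exists>A. open A \<and> \<sigma> \<in> A \<and> (\<forall>y\<in>Omega_S. y \<in> A \<longrightarrow> f y \<in> B)" by blast
qed

lemma continuous_on_Omega_S_bounded:
  fixes f :: "'d::finite config \<Rightarrow> real"
  assumes "continuous_on Omega_S f"
  obtains B where "B > 0" "\<And>\<sigma>. \<sigma> \<in> Omega_S \<Longrightarrow> \<bar>f \<sigma>\<bar> \<le> B"
proof -
  have "bounded (f ` Omega_S)"
    using assms compact_Omega_S compact_continuous_image compact_imp_bounded by blast
  then obtain B where "B > 0" "\<forall>y\<in>f ` Omega_S. norm y \<le> B"
    by (auto simp: bounded_pos)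
  thus thesis by (intro that[of B]) auto
qed

section \<open>Integrals of continuous functions, and oscillations\<close>

lemma prob_measures_on_OmegaD:
  assumes "\<mu> \<in> prob_measures_on_Omega"
  shows "prob_space \<mu>" "sets \<mu> = sets (restrict_space borel Omega_S)" "space \<mu> = Omega_S"
  using assms sets_eq_imp_space_eq[of \<mu> "restrict_space borel Omega_S"]
  by (auto simp: prob_measures_on_Omega_def space_restrict_space)

lemma continuous_on_measurable:
  fixes f :: "'d::finite config \<Rightarrow> real"
  assumes "sets \<mu> = sets (restrict_space borel Omega_S)" and "continuous_on Omega_S f"
  shows "f \<in> borel_measurable \<mu>"
  using borel_measurable_continuous_on_restrict[OF assms(2)] measurable_cong_sets[OF assms(1) refl]
  by blast

lemma continuous_on_integrable:
  fixes f :: "'d::finite config \<Rightarrow> real"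
  assumes \<mu>: "\<mu> \<in> prob_measures_on_Omega" and f: "continuous_on Omega_S f"
  shows "integrable \<mu> f"
proof -
  interpret prob_space \<mu> using \<mu> by (rule prob_measures_on_OmegaD)
  obtain B where "\<And>\<sigma>. \<sigma> \<in> Omega_S \<Longrightarrow> \<bar>f \<sigma>\<bar> \<le> B"
    using continuous_on_Omega_S_bounded[OF f] by blast
  thus ?thesis
    using continuous_on_measurable[OF prob_measures_on_OmegaD(2)[OF \<mu>] f]
    by (intro integrable_const_bound[of _ B]) (auto simp: prob_measures_on_OmegaD(3)[OF \<mu>])
qed

lemma osc_bound:
  fixes f :: "'d::finite config \<Rightarrow> real"
  assumes f: "continuous_on Omega_S f" and \<sigma>: "\<sigma> \<in> Omega_S"
  shows "f (\<sigma>(x := - \<sigma> x)) - f \<sigma> \<le> osc x f"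
proof -
  obtain B where B: "\<And>\<sigma>. \<sigma> \<in> Omega_S \<Longrightarrow> \<bar>f \<sigma>\<bar> \<le> B"
    using continuous_on_Omega_S_bounded[OF f] by blast
  have "f (\<eta>(x := - \<eta> x)) - f \<eta> \<le> 2 * B" if "\<eta> \<in> Omega_S" for \<eta>
    using B[OF that] B[OF Omega_S_flip[OF that], of x] by (auto simp: abs_le_iff)
  \<comment> \<open>A real \<open>SUP\<close> is informative only on a set bounded above; continuity
    on a compact space supplies the bound.\<close>
  hence "bdd_above ((\<lambda>\<sigma>. f (\<sigma>(x := - \<sigma> x)) - f \<sigma>) ` Omega_S)"
    by (auto intro!: bdd_aboveI2)
  thus ?thesis unfolding osc_def using \<sigma> by (intro cSUP_upper)
qed

text \<open>Although \<open>osc\<close> is a supremum of signed differences, it bounds absolute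
  values: flipping is an involution, so both signs occur.\<close>

lemma osc_bound_upd:
  fixes f :: "'d::finite config \<Rightarrow> real"
  assumes f: "continuous_on Omega_S f" and \<sigma>: "\<sigma> \<in> Omega_S" and s: "s \<in> {-1, 1}" "t \<in> {-1, 1}"
  shows "\<bar>f (\<sigma>(x := s)) - f (\<sigma>(x := t))\<bar> \<le> osc x f"
proof -
  have 1: "f (\<sigma>(x := 1)) - f (\<sigma>(x := -1)) \<le> osc x f"
    using osc_bound[OF f Omega_S_upd[OF \<sigma>, of "-1" x], of x] by simp
  have 2: "f (\<sigma>(x := -1)) - f (\<sigma>(x := 1)) \<le> osc x f"
    using osc_bound[OF f Omega_S_upd[OF \<sigma>, of 1 x], of x] by simp
  show ?thesis using 1 2 s by (auto simp: abs_le_iff)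
qed

lemma osc_nonneg:
  fixes f :: "'d::finite config \<Rightarrow> real"
  assumes "continuous_on Omega_S f"
  shows "0 \<le> osc x f"
  using osc_bound_upd[OF assms one_in_Omega_S, of 1 1 x] by simp

lemma osc_least:
  fixes f :: "'d::finite config \<Rightarrow> real"
  assumes "\<And>\<sigma>. \<sigma> \<in> Omega_S \<Longrightarrow> f (\<sigma>(x := - \<sigma> x)) - f \<sigma> \<le> K"
  shows "osc x f \<le> K"
  unfolding osc_def using assms Omega_S_not_empty by (intro cSUP_least)

lemma osc_eq_0:
  fixes f :: "'d::finite config \<Rightarrow> real"
  assumes f: "depends_on \<Lambda> f" and x: "x \<notin> \<Lambda>"
  shows "osc x f = 0"
proof -
  have "f (\<sigma>(x := - \<sigma> x)) - f \<sigma> = 0" if \<sigma>: "\<sigma> \<in> Omega_S" for \<sigma>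
    using x by (simp, intro depends_onD[OF f Omega_S_flip[OF \<sigma>] \<sigma>]) auto
  thus ?thesis by (simp add: osc_def Omega_S_not_empty cong: SUP_cong_simp)
qed

lemma infsum_osc:
  fixes f :: "'d::finite config \<Rightarrow> real"
  assumes "finite \<Lambda>" and f: "depends_on \<Lambda> f"
  shows "(\<Sum>\<^sub>\<infinity>x. (osc x f)\<^sup>2) = (\<Sum>x\<in>\<Lambda>. (osc x f)\<^sup>2)"
  by (subst infsum_finite[symmetric, OF assms(1)])
     (auto intro!: infsum_cong_neutral simp: osc_eq_0[OF f])

text \<open>Inside \<open>\<Lambda>\<close> the flip commutes with freezing, so the supremum runs
  over fewer configurations; at a frozen site the oscillation is 0.\<close>

lemma osc_clamp_le:
  fixes f :: "'d::finite config \<Rightarrow> real"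
  assumes f: "continuous_on Omega_S f"
  shows "osc x (\<lambda>\<sigma>. f (clamp \<Lambda> \<sigma>)) \<le> osc x f"
proof (cases "x \<in> \<Lambda>")
  case True
  show ?thesis
  proof (rule osc_least)
    fix \<sigma> :: "'d config" assume "\<sigma> \<in> Omega_S"
    moreover have "clamp \<Lambda> (\<sigma>(x := - \<sigma> x)) = (clamp \<Lambda> \<sigma>)(x := - clamp \<Lambda> \<sigma> x)"
      using True by (auto simp: clamp_def)
    ultimately show "f (clamp \<Lambda> (\<sigma>(x := - \<sigma> x))) - f (clamp \<Lambda> \<sigma>) \<le> osc x f"
      using osc_bound[OF f clamp_in_Omega_S] by simp
  qed
next
  case False
  thus ?thesis
    using osc_eq_0[OF depends_on_clamp, of x \<Lambda> f] osc_nonneg[OF f, of x] by simp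
qed

lemma depends_on_diff_le:
  fixes f :: "'d::finite config \<Rightarrow> real"
  assumes fin: "finite \<Lambda>" and f: "depends_on \<Lambda> f"
    and \<sigma>: "\<sigma> \<in> Omega_S" and \<sigma>': "\<sigma>' \<in> Omega_S"
  shows "\<bar>f \<sigma> - f \<sigma>'\<bar> \<le> (\<Sum>x\<in>\<Lambda>. osc x f)"
proof -
  have cont: "continuous_on Omega_S f" by (rule depends_on_continuous_on[OF fin f])
  \<comment> \<open>Interpolates from \<open>\<sigma>'\<close> to \<open>\<sigma>\<close>: adding
    one site to \<open>A\<close> changes at most one spin, at the cost of one oscillation.\<close>
  define \<tau> where "\<tau> A x = (if x \<in> A then \<sigma> x else \<sigma>' x)" for A and x :: "int ^ 'd"
  have \<tau>: "\<tau> A \<in> Omega_S" for A using \<sigma> \<sigma>' by (auto simp: \<tau>_def Omega_S_def)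
  have "\<bar>f (\<tau> A) - f \<sigma>'\<bar> \<le> (\<Sum>x\<in>A. osc x f)" if "finite A" for A
    using that
  proof (induction A rule: finite_induct)
    case empty
    then show ?case by (simp add: \<tau>_def)
  next
    case (insert x A)
    have "\<tau> (insert x A) = (\<tau> A)(x := \<sigma> x)" "(\<tau> A)(x := \<sigma>' x) = \<tau> A"
      using insert by (auto simp: \<tau>_def)
    with osc_bound_upd[OF cont \<tau>[of A], of "\<sigma> x" "\<sigma>' x" x] \<sigma> \<sigma>'
    have "\<bar>f (\<tau> (insert x A)) - f (\<tau> A)\<bar> \<le> osc x f"
      by (auto simp: Omega_S_def)
    with insert show ?case by simp
  qed
  moreover have "f \<sigma> = f (\<tau> \<Lambda>)" by (rule depends_onD[OF f \<sigma> \<tau>]) (simp add: \<tau>_def)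
  ultimately show ?thesis using fin by metis
qed

section \<open>Product measures by averaging one site at a time\<close>

text \<open>Integrates out the spin at \<open>x\<close> when it is +1 with probability
  \<open>p x\<close>. Iterated over a list covering the support of f, it gives the product
  expectation as a polynomial in finitely many \<open>p x\<close>, so that estimates for product
  measures become inductions on the list.\<close>

definition avg1 :: "(int ^ 'd::finite \<Rightarrow> real) \<Rightarrow> int ^ 'd \<Rightarrow> ('d config \<Rightarrow> real) \<Rightarrow> 'd config \<Rightarrow> real" where
  "avg1 p x f \<sigma> = p x * f (\<sigma>(x := 1)) + (1 - p x) * f (\<sigma>(x := -1))"

primrec avg :: "(int ^ 'd::finite \<Rightarrow> real) \<Rightarrow> (int ^ 'd) list \<Rightarrow> ('d config \<Rightarrow> real) \<Rightarrow> 'd config \<Rightarrow> real" where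
  "avg p [] f = f"
| "avg p (x # xs) f = avg1 p x (avg p xs f)"

lemma depends_on_avg1:
  assumes "depends_on \<Lambda> f"
  shows "depends_on (\<Lambda> - {x}) (avg1 p x f)"
  unfolding depends_on_def
proof (intro ballI impI)
  fix \<sigma> \<sigma>' :: "'a config" assume \<sigma>: "\<sigma> \<in> Omega_S" "\<sigma>' \<in> Omega_S" "\<forall>y\<in>\<Lambda> - {x}. \<sigma> y = \<sigma>' y"
  have "f (\<sigma>(x := s)) = f (\<sigma>'(x := s))" if "s \<in> {-1, 1}" for s
    using \<sigma> by (intro depends_onD[OF assms Omega_S_upd[OF \<sigma>(1) that] Omega_S_upd[OF \<sigma>(2) that]]) auto
  thus "avg1 p x f \<sigma> = avg1 p x f \<sigma>'"
    by (simp add: avg1_def)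
qed

lemma depends_on_avg: "depends_on \<Lambda> f \<Longrightarrow> depends_on (\<Lambda> - set xs) (avg p xs f)"
proof (induction xs)
  case (Cons x xs)
  have "\<Lambda> - set (x # xs) = \<Lambda> - set xs - {x}" by auto
  thus ?case
    using depends_on_avg1[OF Cons.IH[OF Cons.prems], of x p] by (simp only: avg.simps)
qed simp

lemma depends_on_avg': "depends_on \<Lambda> f \<Longrightarrow> depends_on \<Lambda> (avg p xs f)"
  by (rule depends_on_mono[OF depends_on_avg]) auto

text \<open>At \<open>y = x\<close> the average no longer sees the spin; elsewhere its increment is
  a convex combination of increments of f.\<close>

lemma osc_avg1_le:
  assumes p: "p x \<in> {0..1}" and f: "continuous_on Omega_S f"
  shows "osc y (avg1 p x f) \<le> osc y f"
proof (cases "y = x")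
  case True
  thus ?thesis using osc_nonneg[OF f] by (intro osc_least) (simp add: avg1_def)
next
  case False
  show ?thesis
  proof (rule osc_least)
    fix \<sigma> :: "'a config" assume \<sigma>: "\<sigma> \<in> Omega_S"
    have *: "f (\<sigma>(y := - \<sigma> y, x := s)) - f (\<sigma>(x := s)) \<le> osc y f" if "s \<in> {-1, 1}" for s
      using osc_bound[OF f Omega_S_upd[OF \<sigma> that], of x y] False by (simp add: fun_upd_twist)
    have "avg1 p x f (\<sigma>(y := - \<sigma> y)) - avg1 p x f \<sigma>
        = p x * (f (\<sigma>(y := - \<sigma> y, x := 1)) - f (\<sigma>(x := 1)))
          + (1 - p x) * (f (\<sigma>(y := - \<sigma> y, x := -1)) - f (\<sigma>(x := -1)))"
      by (simp add: avg1_def algebra_simps)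
    also have "\<dots> \<le> p x * osc y f + (1 - p x) * osc y f"
      using p * by (intro add_mono mult_left_mono) auto
    finally show "avg1 p x f (\<sigma>(y := - \<sigma> y)) - avg1 p x f \<sigma> \<le> osc y f"
      by (simp add: algebra_simps)
  qed
qed

lemma osc_avg_le:
  assumes p: "\<And>x. p x \<in> {0..1}" and fin: "finite \<Lambda>" and f: "depends_on \<Lambda> f"
  shows "osc y (avg p xs f) \<le> osc y f"
proof (induction xs)
  case (Cons x xs)
  have "continuous_on Omega_S (avg p xs f)"
    by (rule depends_on_continuous_on[OF fin depends_on_avg'[OF f]])
  from osc_avg1_le[where f = "avg p xs f", where p = p, OF p this, of y x] Cons show ?case by simp
qed simp

text \<open>Hoeffding's lemma for a two-point law. \<open>Hoeffdings_lemma_aux\<close> is applied to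
  a gap \<open>h \<ge> 0\<close>; the other order follows by exchanging the two points, hence
  \<open>p\<close> and \<open>1 - p\<close>.\<close>

lemma Hoeffding_two_point:
  fixes p a b :: real
  assumes "p \<in> {0..1}"
  shows "p * exp a + (1 - p) * exp b \<le> exp (p * a + (1 - p) * b + (a - b)\<^sup>2 / 8)"
proof -
  have *: "q * exp u + (1 - q) * exp v \<le> exp (q * u + (1 - q) * v + (u - v)\<^sup>2 / 8)"
    if q: "q \<in> {0..1}" and uv: "v \<le> u" for q u v :: real
  proof -
    define h where "h = u - v"
    have h: "h \<ge> 0" using uv by (simp add: h_def)
    have pos: "1 + q * (exp h - 1) > 0"
      using q h by (intro add_pos_nonneg mult_nonneg_nonneg) auto
    have "- h * q + ln (1 + q * (exp h - 1)) \<le> h\<^sup>2 / 8"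
      using q h by (intro Hoeffdings_lemma_aux) auto
    hence "ln (1 + q * (exp h - 1)) \<le> q * h + h\<^sup>2 / 8" by (simp add: mult.commute)
    hence "1 + q * (exp h - 1) \<le> exp (q * h + h\<^sup>2 / 8)"
      using pos by (metis exp_le_cancel_iff exp_ln)
    hence "exp v * (1 + q * (exp h - 1)) \<le> exp v * exp (q * h + h\<^sup>2 / 8)"
      by (intro mult_left_mono) auto
    also have "\<dots> = exp (q * u + (1 - q) * v + (u - v)\<^sup>2 / 8)"
      by (simp add: exp_add[symmetric] h_def algebra_simps)
    also have "exp v * (1 + q * (exp h - 1)) = q * exp u + (1 - q) * exp v"
      by (simp add: h_def exp_diff field_simps)
    finally show ?thesis .
  qed
  show ?thesis
  proof (cases "b \<le> a")
    case True
    thus ?thesis using *[OF assms] by simp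
  next
    case False
    thus ?thesis using *[of "1 - p" a b] assms by (simp add: power2_commute add.commute)
  qed
qed

text \<open>The bounded-difference argument of McDiarmid: averaging over the remaining sites leaves
  a function g whose two values at \<open>x\<close> differ by at most \<open>osc x f\<close>, so
  Hoeffding charges an eighth of its square per site.\<close>

lemma avg_exp_le:
  assumes p: "\<And>x. p x \<in> {0..1}" and fin: "finite \<Lambda>" and f: "depends_on \<Lambda> f"
  shows "\<sigma> \<in> Omega_S \<Longrightarrow>
    avg p xs (\<lambda>\<sigma>. exp (f \<sigma>)) \<sigma> \<le> exp (avg p xs f \<sigma> + (\<Sum>x\<leftarrow>xs. (osc x f)\<^sup>2) / 8)"
proof (induction xs arbitrary: \<sigma>)
  case (Cons x xs)
  let ?S = "(\<Sum>x\<leftarrow>xs. (osc x f)\<^sup>2) / 8"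
  define g where "g = avg p xs f"
  have cont: "continuous_on Omega_S g"
    unfolding g_def by (rule depends_on_continuous_on[OF fin depends_on_avg'[OF f]])
  have "\<bar>g (\<sigma>(x := 1)) - g (\<sigma>(x := -1))\<bar> \<le> osc x g"
    by (rule osc_bound_upd[OF cont Cons.prems]) auto
  also have "\<dots> \<le> osc x f"
    unfolding g_def by (rule osc_avg_le[OF p fin f])
  finally have diff: "(g (\<sigma>(x := 1)) - g (\<sigma>(x := -1)))\<^sup>2 \<le> (osc x f)\<^sup>2"
    by (simp add: abs_le_square_iff[symmetric])
  have IH: "avg p xs (\<lambda>\<sigma>. exp (f \<sigma>)) (\<sigma>(x := s)) \<le> exp (g (\<sigma>(x := s)) + ?S)" if "s \<in> {-1, 1}" for s
    unfolding g_def by (rule Cons.IH[OF Omega_S_upd[OF Cons.prems that]])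
  have "avg p (x # xs) (\<lambda>\<sigma>. exp (f \<sigma>)) \<sigma> \<le> avg1 p x (\<lambda>\<sigma>. exp (g \<sigma> + ?S)) \<sigma>"
    using p[of x] IH by (simp add: avg1_def add_mono mult_left_mono)
  also have "\<dots> = (p x * exp (g (\<sigma>(x := 1))) + (1 - p x) * exp (g (\<sigma>(x := -1)))) * exp ?S"
    by (simp add: avg1_def exp_add algebra_simps)
  also have "\<dots> \<le> exp (p x * g (\<sigma>(x := 1)) + (1 - p x) * g (\<sigma>(x := -1))
                        + (g (\<sigma>(x := 1)) - g (\<sigma>(x := -1)))\<^sup>2 / 8) * exp ?S"
    by (intro mult_right_mono Hoeffding_two_point p) auto
  also have "\<dots> \<le> exp (avg1 p x g \<sigma> + (osc x f)\<^sup>2 / 8) * exp ?S"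
    using diff by (intro mult_right_mono) (auto simp: avg1_def)
  also have "\<dots> = exp (avg p (x # xs) f \<sigma> + (\<Sum>x\<leftarrow>x # xs. (osc x f)\<^sup>2) / 8)"
    by (simp add: exp_add[symmetric] g_def add_divide_distrib)
  finally show ?case .
qed simp

lemma avg_lipschitz:
  assumes p: "\<And>x. p x \<in> {0..1}" and q: "\<And>x. q x \<in> {0..1}"
    and fin: "finite \<Lambda>" and f: "depends_on \<Lambda> f"
  shows "\<sigma> \<in> Omega_S \<Longrightarrow> \<bar>avg p xs f \<sigma> - avg q xs f \<sigma>\<bar> \<le> (\<Sum>x\<leftarrow>xs. \<bar>p x - q x\<bar> * osc x f)"
proof (induction xs arbitrary: \<sigma>)
  case (Cons x xs)
  let ?S = "\<Sum>x\<leftarrow>xs. \<bar>p x - q x\<bar> * osc x f"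
  define g h where "g = avg p xs f" and "h = avg q xs f"
  have cont: "continuous_on Omega_S g"
    unfolding g_def by (rule depends_on_continuous_on[OF fin depends_on_avg'[OF f]])
  have "\<bar>g (\<sigma>(x := 1)) - g (\<sigma>(x := -1))\<bar> \<le> osc x g"
    by (rule osc_bound_upd[OF cont Cons.prems]) auto
  also have "\<dots> \<le> osc x f"
    unfolding g_def by (rule osc_avg_le[OF p fin f])
  finally have diff: "\<bar>g (\<sigma>(x := 1)) - g (\<sigma>(x := -1))\<bar> \<le> osc x f" .
  have IH: "\<bar>g (\<sigma>(x := s)) - h (\<sigma>(x := s))\<bar> \<le> ?S" if "s \<in> {-1, 1}" for s
    unfolding g_def h_def by (rule Cons.IH[OF Omega_S_upd[OF Cons.prems that]])
  \<comment> \<open>The first term exchanges the marginal at \<open>x\<close> and costs one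
    oscillation; the second averages the error from the other sites with the weights of
    \<open>q\<close>, which does not enlarge it.\<close>
  have "avg1 p x g \<sigma> - avg1 q x h \<sigma> = (p x - q x) * (g (\<sigma>(x := 1)) - g (\<sigma>(x := -1)))
      + (q x * (g (\<sigma>(x := 1)) - h (\<sigma>(x := 1))) + (1 - q x) * (g (\<sigma>(x := -1)) - h (\<sigma>(x := -1))))"
    by (simp add: avg1_def algebra_simps)
  hence "\<bar>avg1 p x g \<sigma> - avg1 q x h \<sigma>\<bar>
      \<le> \<bar>p x - q x\<bar> * \<bar>g (\<sigma>(x := 1)) - g (\<sigma>(x := -1))\<bar>
        + (\<bar>q x\<bar> * \<bar>g (\<sigma>(x := 1)) - h (\<sigma>(x := 1))\<bar>
           + \<bar>1 - q x\<bar> * \<bar>g (\<sigma>(x := -1)) - h (\<sigma>(x := -1))\<bar>)"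
    unfolding abs_mult[symmetric] by linarith
  also have "\<dots> \<le> \<bar>p x - q x\<bar> * osc x f + (\<bar>q x\<bar> * ?S + \<bar>1 - q x\<bar> * ?S)"
    using diff IH by (intro add_mono mult_left_mono) auto
  also have "\<bar>q x\<bar> * ?S + \<bar>1 - q x\<bar> * ?S = ?S"
    using q[of x] by (simp add: algebra_simps)
  finally show ?case by (simp add: g_def h_def)
qed simp

section \<open>Infinite products of two-point laws\<close>

context
  fixes M :: "int ^ 'd::finite \<Rightarrow> real measure"
  assumes prob_M: "\<And>x. prob_space (M x)"
    and sets_M: "\<And>x. sets (M x) = sets (count_space {-1, 1})"
begin

lemma PiM_in_prob_measures: "PiM UNIV M \<in> prob_measures_on_Omega"
proof -
  have "sets (PiM UNIV M) = sets (PiM UNIV (\<lambda>_ :: int ^ 'd. count_space {-1, 1 :: real}))"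
    by (intro sets_PiM_cong refl sets_M)
  thus ?thesis
    using prob_space_PiM[of UNIV M] prob_M
    by (simp add: prob_measures_on_Omega_def sets_Omega_S_eq_PiM)
qed

lemma measure_M_in: "measure (M x) {1} \<in> {0..1}"
  using prob_space.prob_le_1[OF prob_M] by simp

lemma integral_M:
  fixes g :: "real \<Rightarrow> real"
  shows "integral\<^sup>L (M x) g = measure (M x) {1} * g 1 + (1 - measure (M x) {1}) * g (-1)"
proof -
  interpret prob_space "M x" by (rule prob_M)
  have space: "space (M x) = {-1, 1}"
    using sets_eq_imp_space_eq[OF sets_M[of x]] by simp
  have [measurable]: "{1} \<in> sets (M x)" "{-1} \<in> sets (M x)"
    by (simp_all add: sets_M)
  have "{-1} = space (M x) - {1}" by (auto simp: space)
  hence m1: "measure (M x) {-1} = 1 - measure (M x) {1}"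
    by (simp add: prob_compl)
  have "integral\<^sup>L (M x) g = (\<integral>s. indicator {1} s * g 1 + indicator {-1} s * g (-1) \<partial>M x)"
    by (intro Bochner_Integration.integral_cong) (auto simp: space)
  also have "\<dots> = measure (M x) {1} * g 1 + (1 - measure (M x) {1}) * g (-1)"
    by (subst Bochner_Integration.integral_add) (auto simp: m1 emeasure_eq_measure)
  finally show ?thesis .
qed

text \<open>Resampling the spin at \<open>x\<close> from \<open>M x\<close>, independently of
  everything else, preserves the product law (\<open>distr_pair_PiM_eq_PiM\<close>); Fubini then
  splits off the fresh spin.\<close>

lemma integral_PiM_avg1:
  assumes f: "finite \<Lambda>" "depends_on \<Lambda> f"
  shows "integral\<^sup>L (PiM UNIV M) f = integral\<^sup>L (PiM UNIV M) (avg1 (\<lambda>x. measure (M x) {1}) x f)"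
proof -
  let ?P = "PiM UNIV M"
  interpret Q: prob_space ?P using prob_M by (intro prob_space_PiM)
  interpret Mx: prob_space "M x" by (rule prob_M)
  interpret pair: pair_prob_space "M x" ?P ..
  note P = PiM_in_prob_measures
  have cont: "continuous_on Omega_S f" by (rule depends_on_continuous_on[OF f])
  have f_meas [measurable]: "f \<in> borel_measurable ?P"
    using continuous_on_measurable[OF prob_measures_on_OmegaD(2)[OF P] cont] .
  have upd [measurable]: "(\<lambda>(s, X). X(x := s)) \<in> M x \<Otimes>\<^sub>M ?P \<rightarrow>\<^sub>M ?P"
    
    using measurable_compose[OF measurable_pair_swap' measurable_add_dim[of x UNIV M]]
    by (simp add: case_prod_unfold)
  have dist: "distr (M x \<Otimes>\<^sub>M ?P) ?P (\<lambda>(s, X). X(x := s)) = ?P"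
    using distr_pair_PiM_eq_PiM[of UNIV M x] prob_M by simp
  obtain B where B: "\<And>\<sigma>. \<sigma> \<in> Omega_S \<Longrightarrow> \<bar>f \<sigma>\<bar> \<le> B"
    using continuous_on_Omega_S_bounded[OF cont] by blast
  have int: "integrable ?P (\<lambda>X. f (X(x := s)))" if "s \<in> {-1, 1}" for s
  proof -
    have "depends_on \<Lambda> (\<lambda>X. f (X(x := s)))"
      unfolding depends_on_def
      using that by (intro ballI impI depends_onD[OF f(2) Omega_S_upd Omega_S_upd]) auto
    thus ?thesis by (intro continuous_on_integrable[OF P] depends_on_continuous_on[OF f(1)])
  qed
  have "integral\<^sup>L ?P f = integral\<^sup>L (distr (M x \<Otimes>\<^sub>M ?P) ?P (\<lambda>(s, X). X(x := s))) f"
    by (simp only: dist)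
  also have "\<dots> = integral\<^sup>L (M x \<Otimes>\<^sub>M ?P) (\<lambda>(s, X). f (X(x := s)))"
    by (subst integral_distr) (auto simp: case_prod_unfold)
  also have "\<dots> = (\<integral>s. (\<integral>X. f (X(x := s)) \<partial>?P) \<partial>M x)"
  proof -
    have "space (M x) = {-1, 1}"
      using sets_eq_imp_space_eq[OF sets_M[of x]] by simp
    moreover have "\<bar>f (X(x := s))\<bar> \<le> B" if "X \<in> Omega_S" "s \<in> {-1, 1}" for X s
      using that by (intro B Omega_S_upd)
    ultimately have "integrable (M x \<Otimes>\<^sub>M ?P) (\<lambda>(s, X). f (X(x := s)))"
      using prob_measures_on_OmegaD(3)[OF P]
      by (intro pair.P.integrable_const_bound[of _ B] AE_I2) (auto simp: space_pair_measure case_prod_unfold)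
    from pair.integral_fst'[OF this] show ?thesis by simp
  qed
  also have "\<dots> = integral\<^sup>L ?P (avg1 (\<lambda>x. measure (M x) {1}) x f)"
    using int by (simp add: integral_M avg1_def[abs_def])
  finally show ?thesis .
qed

lemma integral_PiM_avg:
  assumes f: "finite \<Lambda>" "depends_on \<Lambda> f"
  shows "integral\<^sup>L (PiM UNIV M) f = integral\<^sup>L (PiM UNIV M) (avg (\<lambda>x. measure (M x) {1}) xs f)"
proof (induction xs)
  case (Cons x xs)
  thus ?case
    using integral_PiM_avg1[OF f(1) depends_on_avg'[OF f(2)]] by simp
qed simp

text \<open>Once every site of the support is averaged out, the function is constant on
  \<open>Omega_S\<close>, so any reference \<open>\<sigma>\<close> serves.\<close>

lemma integral_PiM_eq_avg:
  assumes f: "depends_on (set xs) f" and \<sigma>: "\<sigma> \<in> Omega_S"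
  shows "integral\<^sup>L (PiM UNIV M) f = avg (\<lambda>x. measure (M x) {1}) xs f \<sigma>"
proof -
  note P = PiM_in_prob_measures
  interpret P: prob_space "PiM UNIV M" using prob_M by (intro prob_space_PiM)
  let ?p = "\<lambda>x. measure (M x) {1}"
  have const: "avg ?p xs f \<eta> = avg ?p xs f \<sigma>" if "\<eta> \<in> space (PiM UNIV M)" for \<eta>
    using that \<sigma> unfolding prob_measures_on_OmegaD(3)[OF P]
    by (intro depends_onD[OF depends_on_avg[OF f]]) auto
  have "integral\<^sup>L (PiM UNIV M) f = integral\<^sup>L (PiM UNIV M) (avg ?p xs f)"
    by (rule integral_PiM_avg[OF finite_set f])
  also have "\<dots> = (\<integral>_. avg ?p xs f \<sigma> \<partial>PiM UNIV M)"
    using const by (intro Bochner_Integration.integral_cong) auto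
  finally show ?thesis by (simp add: P.prob_space)
qed

end

section \<open>The kernel of the automaton\<close>

lemma has_sum_finite_sum:
  fixes f :: "'a \<Rightarrow> 'b \<Rightarrow> real"
  assumes "finite Z" and "\<And>z. z \<in> Z \<Longrightarrow> (f z has_sum s z) A"
  shows "((\<lambda>a. \<Sum>z\<in>Z. f z a) has_sum (\<Sum>z\<in>Z. s z)) A"
  using assms by (induction Z rule: finite_induct) (auto intro!: has_sum_add)

text \<open>The conditional probability of spin +1 at \<open>x\<close> given \<open>\<eta>\<close>,
  in the form that \<open>avg\<close> takes.\<close>

definition pvec :: "((int ^ 'd::finite) set \<Rightarrow> real) \<Rightarrow> 'd config \<Rightarrow> int ^ 'd \<Rightarrow> real" where
  "pvec r \<eta> x = (1 + pca_h r x \<eta>) / 2"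

text \<open>The function \<open>a\<close> of the overview. The indicator keeps the index set of
  \<open>pca_h\<close>, so that the two series compare term by term.\<close>

definition influence :: "((int ^ 'd::finite) set \<Rightarrow> real) \<Rightarrow> int ^ 'd \<Rightarrow> real" where
  "influence r z = (\<Sum>\<^sub>\<infinity>A\<in>{A. finite A}. of_bool (z \<in> A) * \<bar>r A\<bar>)"

definition spin_measure :: "real \<Rightarrow> real measure" where
  "spin_measure m = point_measure {-1, 1} (\<lambda>s. ennreal (1/2 * (1 + s * m)))"

lemma sets_spin_measure: "sets (spin_measure m) = sets (count_space {-1, 1})"
  by (simp add: spin_measure_def sets_point_measure)

lemma spin_weight_nonneg:
  fixes m :: real
  shows "\<bar>m\<bar> \<le> 1 \<Longrightarrow> s \<in> {-1, 1} \<Longrightarrow> 0 \<le> 1/2 * (1 + s * m)"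
  by (auto simp: abs_le_iff)

lemma prob_space_spin_measure:
  assumes "\<bar>m\<bar> \<le> 1"
  shows "prob_space (spin_measure m)"
proof
  have "emeasure (spin_measure m) (space (spin_measure m)) = (\<Sum>s\<in>{-1, 1}. ennreal (1/2 * (1 + s * m)))"
    unfolding spin_measure_def space_point_measure by (rule emeasure_point_measure_finite) auto
  also have "\<dots> = ennreal (\<Sum>s\<in>{-1, 1}. 1/2 * (1 + s * m))"
    by (rule sum_ennreal) (rule spin_weight_nonneg[OF assms])
  also have "\<dots> = 1" by (simp add: field_simps)
  finally show "emeasure (spin_measure m) (space (spin_measure m)) = 1" .
qed

lemma measure_spin_measure: "\<bar>m\<bar> \<le> 1 \<Longrightarrow> measure (spin_measure m) {1} = (1 + m) / 2"
  using spin_weight_nonneg[of m 1]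
  by (simp add: spin_measure_def measure_def emeasure_point_measure_finite)

definition pca_op ::
    "((int ^ 'd::finite) set \<Rightarrow> real) \<Rightarrow> ('d config \<Rightarrow> real) \<Rightarrow> 'd config \<Rightarrow> real" where
  "pca_op r f \<eta> = (\<integral>\<sigma>. f \<sigma> \<partial>pca_kernel r \<eta>)"

lemma abs_prod_Omega_S:
  assumes "\<eta> \<in> Omega_S"
  shows "\<bar>\<Prod>y\<in>B. \<eta> y\<bar> = 1"
  by (simp add: abs_prod abs_Omega_S[OF assms])

lemma continuous_on_avg:
  assumes "\<And>x. continuous_on S (\<lambda>\<eta>. p \<eta> x)"
  shows "continuous_on S (\<lambda>\<eta>. avg (p \<eta>) xs f \<sigma>)"
proof (induction xs arbitrary: \<sigma>)
  case (Cons x xs)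
  show ?case
    unfolding avg.simps avg1_def by (intro continuous_intros assms Cons.IH)
qed simp

section \<open>Fields, one-step operator and Markov kernel\<close>

context
  fixes r :: "(int ^ 'd::finite) set \<Rightarrow> real"
  assumes pca: "pca r"
begin

lemma r_summable: "(\<lambda>A. \<bar>r A\<bar>) summable_on {A. finite A}"
  using pca by (simp add: pca_def)

lemma pca_h_has_sum:
  assumes "\<eta> \<in> Omega_S"
  shows "((\<lambda>A. r A * (\<Prod>y\<in>(\<lambda>a. a + x) ` A. \<eta> y)) has_sum pca_h r x \<eta>) {A. finite A}"
proof -
  have "(\<lambda>A. norm (r A * (\<Prod>y\<in>(\<lambda>a. a + x) ` A. \<eta> y))) summable_on {A. finite A}"
    using r_summable by (simp add: abs_mult abs_prod_Omega_S[OF assms])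
  from abs_summable_summable[OF this] show ?thesis
    unfolding pca_h_def by (rule has_sum_infsum)
qed

text \<open>Weierstrass M-test: products of spins have modulus 1, so \<open>\<bar>r A\<bar>\<close>
  is a majorant. Besides continuity of the fields, it later justifies termwise integration against
  Walsh functions.\<close>

lemma uniform_limit_pca_h:
  "uniform_limit Omega_S (\<lambda>F \<eta>. \<Sum>A\<in>F. r A * (\<Prod>y\<in>(\<lambda>a. a + x) ` A. \<eta> y)) (pca_h r x)
     (finite_subsets_at_top {A. finite A})"
  by (rule Weierstrass_m_test_general'[OF _ pca_h_has_sum r_summable])
     (simp add: abs_mult abs_prod_Omega_S)

lemma continuous_on_pca_h: "continuous_on Omega_S (pca_h r x)"
  by (rule uniform_limit_theorem[OF _ uniform_limit_pca_h])
     (auto intro!: always_eventually continuous_intros continuous_on_product_coordinates[THEN continuous_on_subset])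

lemma abs_pca_h_le: "\<eta> \<in> Omega_S \<Longrightarrow> \<bar>pca_h r x \<eta>\<bar> \<le> 1"
  using pca by (simp add: pca_def)

lemma pvec_in: "\<eta> \<in> Omega_S \<Longrightarrow> pvec r \<eta> x \<in> {0..1}"
  using abs_pca_h_le[of \<eta> x] by (auto simp: pvec_def abs_le_iff)

lemma continuous_on_pvec: "continuous_on Omega_S (\<lambda>\<eta>. pvec r \<eta> x)"
  unfolding pvec_def by (intro continuous_intros continuous_on_pca_h) auto

lemma influence_has_sum:
  "((\<lambda>A. of_bool (z \<in> A) * \<bar>r A\<bar>) has_sum influence r z) {A. finite A}"
  unfolding influence_def
  by (intro has_sum_infsum summable_on_comparison_test[OF r_summable]) (auto simp: of_bool_def)

lemma influence_nonneg: "0 \<le> influence r z"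
  unfolding influence_def by (intro infsum_nonneg) auto

text \<open>Double counting: \<open>A\<close> contributes once for each of its points in
  \<open>Z\<close>, hence at most \<open>card A\<close> times.\<close>

lemma sum_influence_le:
  assumes S: "(\<lambda>A. real (card A) * \<bar>r A\<bar>) summable_on {A. finite A}" and Z: "finite Z"
  shows "(\<Sum>z\<in>Z. influence r z) \<le> (\<Sum>\<^sub>\<infinity>A\<in>{A. finite A}. real (card A) * \<bar>r A\<bar>)"
proof (rule has_sum_mono)
  show "((\<lambda>A. \<Sum>z\<in>Z. of_bool (z \<in> A) * \<bar>r A\<bar>) has_sum (\<Sum>z\<in>Z. influence r z)) {A. finite A}"
    by (rule has_sum_finite_sum[OF Z influence_has_sum])
  show "((\<lambda>A. real (card A) * \<bar>r A\<bar>) has_sum (\<Sum>\<^sub>\<infinity>A\<in>{A. finite A}. real (card A) * \<bar>r A\<bar>)) {A. finite A}"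
    by (rule has_sum_infsum[OF S])
  fix A :: "(int ^ 'd) set" assume A: "A \<in> {A. finite A}"
  have "(\<Sum>z\<in>Z. of_bool (z \<in> A) * \<bar>r A\<bar>) = real (card (Z \<inter> A)) * \<bar>r A\<bar>"
    using Z by (simp add: sum_distrib_right[symmetric] sum.If_cases of_bool_def)
  also have "\<dots> \<le> real (card A) * \<bar>r A\<bar>"
    using A by (intro mult_right_mono) (auto intro!: card_mono)
  finally show "(\<Sum>z\<in>Z. of_bool (z \<in> A) * \<bar>r A\<bar>) \<le> real (card A) * \<bar>r A\<bar>" .
qed

text \<open>Only the sets whose translate by \<open>x\<close> contains \<open>y\<close>, those with
  \<open>y - x \<in> A\<close>, feel the flip, and such a term moves by at most
  \<open>2 * \<bar>r A\<bar>\<close>.\<close>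

lemma pca_h_flip:
  assumes \<eta>: "\<eta> \<in> Omega_S"
  shows "\<bar>pca_h r x (\<eta>(y := - \<eta> y)) - pca_h r x \<eta>\<bar> \<le> 2 * influence r (y - x)"
proof -
  let ?t = "\<lambda>\<eta> A. r A * (\<Prod>y\<in>(\<lambda>a. a + x) ` A. \<eta> y)"
  let ?\<eta>' = "\<eta>(y := - \<eta> y)"
  have "norm (pca_h r x ?\<eta>' + - pca_h r x \<eta>) \<le> 2 * influence r (y - x)"
  proof (rule norm_infsum_le)
    have "((\<lambda>A. - ?t \<eta> A) has_sum - pca_h r x \<eta>) {A. finite A}"
      using pca_h_has_sum[OF \<eta>] by (simp add: has_sum_uminus)
    with pca_h_has_sum[OF Omega_S_flip[OF \<eta>]]
    show "((\<lambda>A. ?t ?\<eta>' A + - ?t \<eta> A) has_sum (pca_h r x ?\<eta>' + - pca_h r x \<eta>)) {A. finite A}"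
      by (rule has_sum_add)
    show "((\<lambda>A. 2 * (of_bool (y - x \<in> A) * \<bar>r A\<bar>)) has_sum (2 * influence r (y - x))) {A. finite A}"
      by (rule has_sum_cmult_right[OF influence_has_sum])
    fix A :: "(int ^ 'd) set" assume "A \<in> {A. finite A}"
    show "norm (?t ?\<eta>' A + - ?t \<eta> A) \<le> 2 * (of_bool (y - x \<in> A) * \<bar>r A\<bar>)"
    proof (cases "y - x \<in> A")
      case True
      have "norm (?t ?\<eta>' A + - ?t \<eta> A) \<le> norm (?t ?\<eta>' A) + norm (- ?t \<eta> A)"
        by (rule norm_triangle_ineq)
      also have "\<dots> = 2 * \<bar>r A\<bar>"
        by (simp only: norm_minus_cancel real_norm_def abs_mult abs_minus_cancel
              abs_prod_Omega_S[OF Omega_S_flip[OF \<eta>]] abs_prod_Omega_S[OF \<eta>])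
      finally show ?thesis using True by simp
    next
      case False
      hence "y \<notin> (\<lambda>a. a + x) ` A" by (auto simp: algebra_simps)
      hence "(\<Prod>z\<in>(\<lambda>a. a + x) ` A. ?\<eta>' z) = (\<Prod>z\<in>(\<lambda>a. a + x) ` A. \<eta> z)"
        by (intro prod.cong) auto
      thus ?thesis by simp
    qed
  qed
  thus ?thesis by simp
qed

text \<open>The factor 2 from the flip cancels the 1/2 in \<open>pvec\<close>, which is why no
  numerical factor accompanies \<kappa> in the end.\<close>

lemma pvec_flip:
  "\<eta> \<in> Omega_S \<Longrightarrow> \<bar>pvec r (\<eta>(y := - \<eta> y)) x - pvec r \<eta> x\<bar> \<le> influence r (y - x)"
  using pca_h_flip[of \<eta> x y] by (simp add: pvec_def abs_le_iff field_simps)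

context
  fixes \<eta> :: "'d config"
  assumes \<eta>: "\<eta> \<in> Omega_S"
begin

lemma pca_kernel_eq: "pca_kernel r \<eta> = PiM UNIV (\<lambda>x. spin_measure (pca_h r x \<eta>))"
  by (simp add: pca_kernel_def spin_measure_def)

lemma product_measure_pca_kernel: "product_measure (pca_kernel r \<eta>)"
  unfolding product_measure_def pca_kernel_eq
  by (intro exI[of _ "\<lambda>x. spin_measure (pca_h r x \<eta>)"] conjI allI prob_space_spin_measure
      sets_spin_measure refl abs_pca_h_le \<eta>)

lemma pca_kernel_in: "pca_kernel r \<eta> \<in> prob_measures_on_Omega"
  unfolding pca_kernel_eq
  by (rule PiM_in_prob_measures[OF prob_space_spin_measure[OF abs_pca_h_le[OF \<eta>]] sets_spin_measure])

lemma pca_op_eq_avg: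
  assumes "depends_on (set xs) f" "\<sigma> \<in> Omega_S"
  shows "pca_op r f \<eta> = avg (pvec r \<eta>) xs f \<sigma>"
  unfolding pca_op_def pca_kernel_eq
    integral_PiM_eq_avg[OF prob_space_spin_measure[OF abs_pca_h_le[OF \<eta>]] sets_spin_measure assms]
  by (simp add: measure_spin_measure[OF abs_pca_h_le[OF \<eta>]] pvec_def[abs_def])

end

text \<open>The Feller property on local functions: \<open>pca_op r f\<close> may see infinitely
  many spins, but it is a polynomial in finitely many entries of \<open>pvec\<close>, each
  continuous.\<close>

lemma continuous_on_pca_op:
  assumes "finite \<Lambda>" "depends_on \<Lambda> f"
  shows "continuous_on Omega_S (pca_op r f)"
proof -
  obtain xs where xs: "\<Lambda> = set xs" using finite_list[OF assms(1)] by metis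
  have "continuous_on Omega_S (\<lambda>\<eta>. avg (pvec r \<eta>) xs f (\<lambda>_. 1))"
    by (rule continuous_on_avg[OF continuous_on_pvec])
  thus ?thesis
    using pca_op_eq_avg[OF _ assms(2)[unfolded xs] one_in_Omega_S]
    by (simp cong: continuous_on_cong)
qed

lemma osc_pca_op_le:
  assumes fin: "finite \<Lambda>" and f: "depends_on \<Lambda> f"
  shows "osc y (pca_op r f) \<le> (\<Sum>x\<in>\<Lambda>. influence r (y - x) * osc x f)"
proof (rule osc_least)
  fix \<eta> :: "'d config" assume \<eta>: "\<eta> \<in> Omega_S"
  \<comment> \<open>Distinctness is what turns the sum over the list into the sum over
    \<open>\<Lambda>\<close>.\<close>
  obtain xs where xs: "\<Lambda> = set xs" "distinct xs" using finite_distinct_list[OF fin] by metis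
  let ?\<eta>' = "\<eta>(y := - \<eta> y)"
  have \<eta>': "?\<eta>' \<in> Omega_S" by (rule Omega_S_flip[OF \<eta>])
  note eq = pca_op_eq_avg[OF _ f[unfolded xs] one_in_Omega_S]
  have "pca_op r f ?\<eta>' - pca_op r f \<eta>
      \<le> \<bar>avg (pvec r ?\<eta>') xs f (\<lambda>_. 1) - avg (pvec r \<eta>) xs f (\<lambda>_. 1)\<bar>"
    unfolding eq[OF \<eta>] eq[OF \<eta>'] by simp
  also have "\<dots> \<le> (\<Sum>x\<leftarrow>xs. \<bar>pvec r ?\<eta>' x - pvec r \<eta> x\<bar> * osc x f)"
    by (rule avg_lipschitz[OF pvec_in[OF \<eta>'] pvec_in[OF \<eta>] fin f one_in_Omega_S])
  also have "\<dots> = (\<Sum>x\<in>\<Lambda>. \<bar>pvec r ?\<eta>' x - pvec r \<eta> x\<bar> * osc x f)"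
    using xs by (simp add: sum_list_distinct_conv_sum_set)
  also have "\<dots> \<le> (\<Sum>x\<in>\<Lambda>. influence r (y - x) * osc x f)"
    by (intro sum_mono mult_right_mono pvec_flip[OF \<eta>] osc_nonneg depends_on_continuous_on[OF fin f])
  finally show "pca_op r f ?\<eta>' - pca_op r f \<eta> \<le> (\<Sum>x\<in>\<Lambda>. influence r (y - x) * osc x f)" .
qed

text \<open>Cylinder sets form an intersection-stable generator, and on them the mass is a finite
  product of finite sums in the continuous fields.\<close>

lemma measurable_pca_kernel:
  "pca_kernel r \<in> restrict_space borel Omega_S \<rightarrow>\<^sub>M prob_algebra (restrict_space borel Omega_S)"
proof (rule measurable_prob_algebra_generated)
  let ?C = "\<lambda>_ :: int ^ 'd. count_space {-1, 1 :: real}"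
  show "sets (restrict_space borel Omega_S) = sigma_sets (\<Pi>\<^sub>E i\<in>UNIV. space (?C i)) (prod_algebra UNIV ?C)"
    unfolding sets_Omega_S_eq_PiM by (rule sets_PiM)
  show "Int_stable (prod_algebra UNIV ?C)" by (rule Int_stable_prod_algebra)
  show "prod_algebra UNIV ?C \<subseteq> Pow (\<Pi>\<^sub>E i\<in>UNIV. space (?C i))" by (rule prod_algebra_sets_into_space)
  fix \<eta> :: "'d config" assume "\<eta> \<in> space (restrict_space borel Omega_S)"
  hence \<eta>: "\<eta> \<in> Omega_S" by (simp add: space_restrict_space)
  show "prob_space (pca_kernel r \<eta>)"
    "sets (pca_kernel r \<eta>) = sets (restrict_space borel Omega_S)"
    using prob_measures_on_OmegaD[OF pca_kernel_in[OF \<eta>]] by blast+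
next
  let ?C = "\<lambda>_ :: int ^ 'd. count_space {-1, 1 :: real}"
  fix A assume "A \<in> prod_algebra UNIV ?C"
  then obtain J E where A: "A = prod_emb UNIV ?C J (\<Pi>\<^sub>E j\<in>J. E j)" "finite J"
    "\<And>j. j \<in> J \<Longrightarrow> E j \<in> sets (?C j)"
    by (elim prod_algebraE) blast
  have "emeasure (pca_kernel r \<eta>) A
      = (\<Prod>j\<in>J. \<Sum>s\<in>E j. ennreal (1/2 * (1 + s * pca_h r j \<eta>)))" if \<eta>: "\<eta> \<in> Omega_S" for \<eta>
  proof -
    have "A = prod_emb UNIV (\<lambda>x. spin_measure (pca_h r x \<eta>)) J (\<Pi>\<^sub>E j\<in>J. E j)"
      unfolding A(1) prod_emb_def using sets_eq_imp_space_eq[OF sets_spin_measure] by simp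
    hence "emeasure (pca_kernel r \<eta>) A = (\<Prod>j\<in>J. emeasure (spin_measure (pca_h r j \<eta>)) (E j))"
      unfolding pca_kernel_eq[OF \<eta>] using A(2,3)
      by (simp only:)
         (intro emeasure_PiM_emb prob_space_spin_measure abs_pca_h_le \<eta>; simp add: sets_spin_measure)
    also have "\<dots> = (\<Prod>j\<in>J. \<Sum>s\<in>E j. ennreal (1/2 * (1 + s * pca_h r j \<eta>)))"
      using A(3) unfolding spin_measure_def
      by (intro prod.cong refl emeasure_point_measure_finite) auto
    finally show ?thesis .
  qed
  moreover have [measurable]: "pca_h r j \<in> borel_measurable (restrict_space borel Omega_S)" for j
    by (rule continuous_on_measurable[OF refl continuous_on_pca_h])
  have "(\<lambda>\<eta>. \<Prod>j\<in>J. \<Sum>s\<in>E j. ennreal (1/2 * (1 + s * pca_h r j \<eta>)))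
      \<in> borel_measurable (restrict_space borel Omega_S)" by measurable
  ultimately show "(\<lambda>\<eta>. emeasure (pca_kernel r \<eta>) A) \<in> borel_measurable (restrict_space borel Omega_S)"
    by (subst measurable_cong) (auto simp: space_restrict_space)
qed

context
  fixes \<mu> :: "'d config measure"
  assumes \<mu>: "\<mu> \<in> prob_measures_on_Omega"
begin

lemma prob_measures_in_prob_algebra: "\<mu> \<in> space (prob_algebra (restrict_space borel Omega_S))"
  using prob_measures_on_OmegaD[OF \<mu>] by (simp add: space_prob_algebra)

lemma pca_push_in: "pca_push r \<mu> \<in> prob_measures_on_Omega"
  unfolding prob_measures_on_Omega_def pca_push_def
  using prob_space_bind'[OF prob_measures_in_prob_algebra measurable_pca_kernel]
    sets_bind'[OF prob_measures_in_prob_algebra measurable_pca_kernel] by simp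

lemma integral_pca_push:
  fixes f :: "'d config \<Rightarrow> real"
  assumes f: "continuous_on Omega_S f"
  shows "integral\<^sup>L (pca_push r \<mu>) f = integral\<^sup>L \<mu> (pca_op r f)"
proof -
  interpret prob_space \<mu> by (rule prob_measures_on_OmegaD[OF \<mu>])
  obtain B where B: "\<And>\<sigma>. \<sigma> \<in> Omega_S \<Longrightarrow> \<bar>f \<sigma>\<bar> \<le> B"
    using continuous_on_Omega_S_bounded[OF f] by blast
  show ?thesis
    unfolding pca_push_def pca_op_def
  proof (rule integral_bind)
    show "f \<in> borel_measurable (restrict_space borel Omega_S)"
      by (rule continuous_on_measurable[OF refl f])
    show "\<bar>f \<sigma>\<bar> \<le> B" if "\<sigma> \<in> space (restrict_space borel Omega_S)" for \<sigma>
      using B that by (simp add: space_restrict_space)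
    show "pca_kernel r \<in> \<mu> \<rightarrow>\<^sub>M subprob_algebra (restrict_space borel Omega_S)"
      using measurable_prob_algebraD[OF measurable_pca_kernel]
      by (simp cong: measurable_cong_sets add: prob_measures_on_OmegaD(2)[OF \<mu>])
    show "finite_measure \<mu>" by (rule finite_measure_axioms)
    have "emeasure (pca_kernel r \<eta>) (space (pca_kernel r \<eta>)) \<le> ennreal 1" if "\<eta> \<in> space \<mu>" for \<eta>
    proof -
      have "prob_space (pca_kernel r \<eta>)"
        using that prob_measures_on_OmegaD(1)[OF pca_kernel_in] prob_measures_on_OmegaD(3)[OF \<mu>] by simp
      thus ?thesis by (simp add: prob_space.emeasure_space_1)
    qed
    thus "AE \<eta> in \<mu>. emeasure (pca_kernel r \<eta>) (space (pca_kernel r \<eta>)) \<le> ennreal 1"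
      by (rule AE_I2)
  qed
qed

end

end

section \<open>Propagation of GCB\<close>

text \<open>After exchanging the sums, each inner sum runs over a translate of \<open>Y\<close>,
  since \<open>y - x\<close> is injective in \<open>y\<close>, and is thus a partial sum of
  \<open>a\<close>.\<close>

lemma Young_l1:
  fixes a u :: "'a::ab_group_add \<Rightarrow> real"
  assumes a: "\<And>Z. finite Z \<Longrightarrow> sum a Z \<le> S" and u: "\<And>x. 0 \<le> u x"
    and fin: "finite Y" "finite \<Lambda>"
  shows "(\<Sum>y\<in>Y. \<Sum>x\<in>\<Lambda>. a (y - x) * u x) \<le> S * (\<Sum>x\<in>\<Lambda>. u x)"
proof -
  have "(\<Sum>y\<in>Y. a (y - x)) \<le> S" for x
  proof -
    have "(\<Sum>y\<in>Y. a (y - x)) = sum a ((\<lambda>y. y - x) ` Y)"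
      by (subst sum.reindex) (auto simp: inj_on_def)
    thus ?thesis using a fin by simp
  qed
  hence "(\<Sum>x\<in>\<Lambda>. (\<Sum>y\<in>Y. a (y - x)) * u x) \<le> (\<Sum>x\<in>\<Lambda>. S * u x)"
    by (intro sum_mono mult_right_mono u)
  thus ?thesis
    by (subst sum.swap) (simp add: sum_distrib_left sum_distrib_right)
qed

text \<open>Schur's test: Cauchy-Schwarz with each weight split into two square roots gives one
  factor \<open>S\<close> from the row sums; \<open>Young_l1\<close> applied to the squares gives
  the other.\<close>

lemma Young_l2:
  fixes a u :: "'a::ab_group_add \<Rightarrow> real"
  assumes a: "\<And>Z. finite Z \<Longrightarrow> sum a Z \<le> S" and nonneg: "\<And>x. 0 \<le> a x"
    and fin: "finite Y" "finite \<Lambda>"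
  shows "(\<Sum>y\<in>Y. (\<Sum>x\<in>\<Lambda>. a (y - x) * u x)\<^sup>2) \<le> S\<^sup>2 * (\<Sum>x\<in>\<Lambda>. (u x)\<^sup>2)"
proof -
  have S: "0 \<le> S" using a[of "{}"] by simp
  have "(\<Sum>x\<in>\<Lambda>. a (y - x) * u x)\<^sup>2 \<le> S * (\<Sum>x\<in>\<Lambda>. a (y - x) * (u x)\<^sup>2)" for y
  proof -
    have "(\<Sum>x\<in>\<Lambda>. a (y - x)) = sum a ((\<lambda>x. y - x) ` \<Lambda>)"
      by (subst sum.reindex) (auto simp: inj_on_def)
    hence le: "(\<Sum>x\<in>\<Lambda>. a (y - x)) \<le> S" using a fin by simp
    have "(\<Sum>x\<in>\<Lambda>. a (y - x) * u x)\<^sup>2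
        = (\<Sum>x\<in>\<Lambda>. sqrt (a (y - x)) * (sqrt (a (y - x)) * u x))\<^sup>2"
      using nonneg by (simp add: mult.assoc[symmetric])
    also have "\<dots> \<le> (\<Sum>x\<in>\<Lambda>. (sqrt (a (y - x)))\<^sup>2) * (\<Sum>x\<in>\<Lambda>. (sqrt (a (y - x)) * u x)\<^sup>2)"
      by (rule Cauchy_Schwarz_ineq_sum)
    also have "\<dots> = (\<Sum>x\<in>\<Lambda>. a (y - x)) * (\<Sum>x\<in>\<Lambda>. a (y - x) * (u x)\<^sup>2)"
      using nonneg by (simp add: power_mult_distrib)
    also have "\<dots> \<le> S * (\<Sum>x\<in>\<Lambda>. a (y - x) * (u x)\<^sup>2)"
      using le nonneg by (intro mult_right_mono sum_nonneg) auto
    finally show ?thesis .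
  qed
  hence "(\<Sum>y\<in>Y. (\<Sum>x\<in>\<Lambda>. a (y - x) * u x)\<^sup>2) \<le> (\<Sum>y\<in>Y. S * (\<Sum>x\<in>\<Lambda>. a (y - x) * (u x)\<^sup>2))"
    by (intro sum_mono)
  also have "\<dots> \<le> S * (S * (\<Sum>x\<in>\<Lambda>. (u x)\<^sup>2))"
    unfolding sum_distrib_left[symmetric]
    using Young_l1[OF a _ fin, of "\<lambda>x. (u x)\<^sup>2"] S by (intro mult_left_mono) auto
  finally show ?thesis by (simp add: power2_eq_square mult.assoc)
qed

section \<open>GCB in exponential form and for continuous functions\<close>

lemma integral_exp_pos:
  fixes f :: "'d::finite config \<Rightarrow> real"
  assumes \<mu>: "\<mu> \<in> prob_measures_on_Omega" and f: "continuous_on Omega_S f"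
  shows "0 < (\<integral>\<sigma>. exp (f \<sigma>) \<partial>\<mu>)"
proof -
  interpret prob_space \<mu> by (rule prob_measures_on_OmegaD[OF \<mu>])
  obtain B where B: "\<And>\<sigma>. \<sigma> \<in> Omega_S \<Longrightarrow> \<bar>f \<sigma>\<bar> \<le> B"
    using continuous_on_Omega_S_bounded[OF f] by blast
  have "exp (- B) \<le> exp (f \<sigma>)" if "\<sigma> \<in> Omega_S" for \<sigma>
    using B[OF that] by (simp add: abs_le_iff)
  hence "(\<integral>\<sigma>. exp (- B) \<partial>\<mu>) \<le> (\<integral>\<sigma>. exp (f \<sigma>) \<partial>\<mu>)"
    by (intro integral_mono continuous_on_integrable[OF \<mu>] continuous_intros f)
       (auto simp: prob_measures_on_OmegaD(3)[OF \<mu>])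
  hence "exp (- B) \<le> (\<integral>\<sigma>. exp (f \<sigma>) \<partial>\<mu>)"
    by (simp add: prob_space)
  thus ?thesis using exp_gt_zero[of "- B"] by linarith
qed

lemma ln_integral_exp_le_iff:
  fixes f :: "'d::finite config \<Rightarrow> real"
  assumes \<mu>: "\<mu> \<in> prob_measures_on_Omega" and f: "continuous_on Omega_S f"
  shows "ln (\<integral>\<sigma>. exp (f \<sigma> - m) \<partial>\<mu>) \<le> K \<longleftrightarrow> (\<integral>\<sigma>. exp (f \<sigma>) \<partial>\<mu>) \<le> exp (m + K)"
proof -
  have pos: "0 < (\<integral>\<sigma>. exp (f \<sigma> - m) \<partial>\<mu>)"
    by (intro integral_exp_pos[OF \<mu>] continuous_intros f)
  have "ln (\<integral>\<sigma>. exp (f \<sigma> - m) \<partial>\<mu>) \<le> K \<longleftrightarrow> (\<integral>\<sigma>. exp (f \<sigma> - m) \<partial>\<mu>) \<le> exp K"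
    using ln_le_cancel_iff[OF pos exp_gt_zero[of K]] by simp
  also have "\<dots> \<longleftrightarrow> (\<integral>\<sigma>. exp (f \<sigma>) \<partial>\<mu>) / exp m \<le> exp K"
    by (simp add: exp_diff)
  also have "\<dots> \<longleftrightarrow> (\<integral>\<sigma>. exp (f \<sigma>) \<partial>\<mu>) \<le> exp (m + K)"
    by (simp add: exp_add field_simps)
  finally show ?thesis .
qed

text \<open>The working form, free of \<open>ln\<close> and of infinite sums. Any finite support may
  serve as \<open>\<Lambda>\<close>, since oscillations vanish off it.\<close>

lemma GCB_iff:
  "GCB C \<mu> \<longleftrightarrow> \<mu> \<in> prob_measures_on_Omega \<and>
     (\<forall>\<Lambda> f. finite \<Lambda> \<longrightarrow> depends_on \<Lambda> f \<longrightarrow>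
        (\<integral>\<sigma>. exp (f \<sigma>) \<partial>\<mu>) \<le> exp ((\<integral>\<sigma>. f \<sigma> \<partial>\<mu>) + C / 2 * (\<Sum>x\<in>\<Lambda>. (osc x f)\<^sup>2)))"
  (is "_ \<longleftrightarrow> _ \<and> ?R")
proof (cases "\<mu> \<in> prob_measures_on_Omega")
  case True
  have "GCB C \<mu> \<longleftrightarrow> (\<forall>\<Lambda> f. finite \<Lambda> \<longrightarrow> depends_on \<Lambda> f \<longrightarrow>
      ln (\<integral>\<sigma>. exp (f \<sigma> - (\<integral>\<sigma>'. f \<sigma>' \<partial>\<mu>)) \<partial>\<mu>) \<le> C / 2 * (\<Sum>\<^sub>\<infinity>x. (osc x f)\<^sup>2))"
    using True unfolding GCB_def local_fun_iff_depends_on by blast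
  also have "\<dots> \<longleftrightarrow> ?R"
    by (intro arg_cong[of _ _ All] ext imp_cong refl)
       (simp only: infsum_osc ln_integral_exp_le_iff[OF True depends_on_continuous_on])
  finally show ?thesis using True by simp
qed (simp add: GCB_def)

lemma GCBI:
  assumes "\<mu> \<in> prob_measures_on_Omega"
    and "\<And>\<Lambda> f. finite \<Lambda> \<Longrightarrow> depends_on \<Lambda> f \<Longrightarrow>
      (\<integral>\<sigma>. exp (f \<sigma>) \<partial>\<mu>) \<le> exp ((\<integral>\<sigma>. f \<sigma> \<partial>\<mu>) + C / 2 * (\<Sum>x\<in>\<Lambda>. (osc x f)\<^sup>2))"
  shows "GCB C \<mu>"
  unfolding GCB_iff by (intro conjI allI impI assms)

lemma GCBD:
  assumes "GCB C \<mu>" "finite \<Lambda>" "depends_on \<Lambda> f"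
  shows "(\<integral>\<sigma>. exp (f \<sigma>) \<partial>\<mu>) \<le> exp ((\<integral>\<sigma>. f \<sigma> \<partial>\<mu>) + C / 2 * (\<Sum>x\<in>\<Lambda>. (osc x f)\<^sup>2))"
  using assms unfolding GCB_iff by blast

text \<open>Jensen's inequality applied to a single spin, whose oscillation is not 0. The sign of
  \<open>C\<close> is what allows a sum of squared oscillations to be replaced by an upper
  bound.\<close>

lemma GCB_nonneg:
  fixes \<mu> :: "'d::finite config measure"
  assumes "GCB C \<mu>"
  shows "0 \<le> C"
proof -
  have \<mu>: "\<mu> \<in> prob_measures_on_Omega" using assms by (simp add: GCB_def)
  interpret prob_space \<mu> by (rule prob_measures_on_OmegaD[OF \<mu>])
  define f :: "'d config \<Rightarrow> real" where "f \<sigma> = \<sigma> 0" for \<sigma>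
  have f: "depends_on {0} f" by (simp add: f_def depends_on_def)
  have cont: "continuous_on Omega_S f" by (rule depends_on_continuous_on[OF _ f]) simp
  define m where "m = integral\<^sup>L \<mu> f"
  \<comment> \<open>Jensen through the tangent line of exp at the mean \<open>m\<close>.\<close>
  have "exp m = (\<integral>\<sigma>. exp m * (1 + (f \<sigma> - m)) \<partial>\<mu>)"
    using continuous_on_integrable[OF \<mu> cont] by (simp add: m_def prob_space)
  also have "\<dots> \<le> (\<integral>\<sigma>. exp (f \<sigma>) \<partial>\<mu>)"
  proof (intro integral_mono continuous_on_integrable[OF \<mu>] continuous_intros cont)
    fix \<sigma>
    have "exp m * (1 + (f \<sigma> - m)) \<le> exp m * exp (f \<sigma> - m)"
      by (intro mult_left_mono exp_ge_add_one_self) auto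
    thus "exp m * (1 + (f \<sigma> - m)) \<le> exp (f \<sigma>)" by (simp add: exp_diff)
  qed
  also have "\<dots> \<le> exp (m + C / 2 * (\<Sum>x\<in>{0}. (osc x f)\<^sup>2))"
    unfolding m_def by (rule GCBD[OF assms _ f]) simp
  finally have "0 \<le> C * (osc 0 f)\<^sup>2" by simp
  moreover have "osc 0 f \<noteq> 0"
    using osc_bound_upd[OF cont one_in_Omega_S, of 1 "-1" 0] by (simp add: f_def)
  ultimately show ?thesis by (simp add: zero_le_mult_iff)
qed

text \<open>Freezing the spins outside a large \<open>\<Lambda>\<close> achieves uniform closeness
  and domination of every oscillation at once; the second is what lets sums of oscillations pass to
  the limit.\<close>

lemma local_approximation:
  fixes g :: "'d::finite config \<Rightarrow> real"
  assumes g: "continuous_on Omega_S g" and e: "e > 0"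
  obtains \<Lambda> f where "finite \<Lambda>" "depends_on \<Lambda> f"
    "\<And>\<sigma>. \<sigma> \<in> Omega_S \<Longrightarrow> \<bar>f \<sigma> - g \<sigma>\<bar> \<le> e" "\<And>x. osc x f \<le> osc x g"
proof -
  obtain \<Lambda> where \<Lambda>: "finite \<Lambda>"
    "\<And>\<sigma> \<sigma>'. \<sigma> \<in> Omega_S \<Longrightarrow> \<sigma>' \<in> Omega_S \<Longrightarrow> (\<And>x. x \<in> \<Lambda> \<Longrightarrow> \<sigma> x = \<sigma>' x) \<Longrightarrow> \<bar>g \<sigma> - g \<sigma>'\<bar> < e"
    using continuous_on_Omega_S_quasilocal[OF g e] by metis
  show thesis
  proof (rule that[of \<Lambda> "\<lambda>\<sigma>. g (clamp \<Lambda> \<sigma>)"])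
    show "\<bar>g (clamp \<Lambda> \<sigma>) - g \<sigma>\<bar> \<le> e" if "\<sigma> \<in> Omega_S" for \<sigma>
      by (intro less_imp_le \<Lambda>(2) clamp_in_Omega_S that) (simp add: clamp_def)
  qed (use \<Lambda>(1) depends_on_clamp osc_clamp_le[OF g] in auto)
qed

lemma GCB_continuous:
  fixes g :: "'d::finite config \<Rightarrow> real"
  assumes GCB: "GCB C \<mu>" and g: "continuous_on Omega_S g"
    and K: "\<And>Y. finite Y \<Longrightarrow> (\<Sum>y\<in>Y. (osc y g)\<^sup>2) \<le> K"
  shows "(\<integral>\<sigma>. exp (g \<sigma>) \<partial>\<mu>) \<le> exp ((\<integral>\<sigma>. g \<sigma> \<partial>\<mu>) + C / 2 * K)"
proof -
  have \<mu>: "\<mu> \<in> prob_measures_on_Omega" using GCB by (simp add: GCB_def)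
  interpret prob_space \<mu> by (rule prob_measures_on_OmegaD[OF \<mu>])
  note int = continuous_on_integrable[OF \<mu>]
  have "ln (\<integral>\<sigma>. exp (g \<sigma>) \<partial>\<mu>) \<le> (\<integral>\<sigma>. g \<sigma> \<partial>\<mu>) + C / 2 * K"
  proof (rule field_le_epsilon)
    fix e' :: real assume "e' > 0"
    \<comment> \<open>One half pays for replacing g by f in the exponential, the other for replacing
      the mean of f by that of g.\<close>
    define e where "e = e' / 2"
    have "e > 0" using \<open>e' > 0\<close> by (simp add: e_def)
    with local_approximation[OF g] obtain \<Lambda> f where f: "finite \<Lambda>" "depends_on \<Lambda> f"
      "\<And>\<sigma>. \<sigma> \<in> Omega_S \<Longrightarrow> \<bar>f \<sigma> - g \<sigma>\<bar> \<le> e" "\<And>x. osc x f \<le> osc x g" by metis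
    have cont: "continuous_on Omega_S f" by (rule depends_on_continuous_on[OF f(1,2)])
    have "(\<Sum>x\<in>\<Lambda>. (osc x f)\<^sup>2) \<le> (\<Sum>x\<in>\<Lambda>. (osc x g)\<^sup>2)"
      using osc_nonneg[OF cont] f(4) by (intro sum_mono power_mono) auto
    also have "\<dots> \<le> K" by (rule K[OF f(1)])
    finally have sum: "(\<Sum>x\<in>\<Lambda>. (osc x f)\<^sup>2) \<le> K" .
    have "(\<integral>\<sigma>. f \<sigma> \<partial>\<mu>) \<le> (\<integral>\<sigma>. g \<sigma> + e \<partial>\<mu>)"
      using f(3) by (intro integral_mono int continuous_intros cont g)
                    (auto simp: prob_measures_on_OmegaD(3)[OF \<mu>] abs_le_iff algebra_simps)
    hence mean: "(\<integral>\<sigma>. f \<sigma> \<partial>\<mu>) \<le> (\<integral>\<sigma>. g \<sigma> \<partial>\<mu>) + e"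
      using int[OF g] by (simp add: prob_space)
    have "(\<integral>\<sigma>. exp (g \<sigma>) \<partial>\<mu>) \<le> (\<integral>\<sigma>. exp e * exp (f \<sigma>) \<partial>\<mu>)"
      using f(3) by (intro integral_mono int continuous_intros cont g)
                    (auto simp: prob_measures_on_OmegaD(3)[OF \<mu>] abs_le_iff algebra_simps
                          simp flip: exp_add)
    also have "\<dots> = exp e * (\<integral>\<sigma>. exp (f \<sigma>) \<partial>\<mu>)" by simp
    also have "\<dots> \<le> exp e * exp ((\<integral>\<sigma>. f \<sigma> \<partial>\<mu>) + C / 2 * (\<Sum>x\<in>\<Lambda>. (osc x f)\<^sup>2))"
      by (intro mult_left_mono GCBD[OF GCB f(1,2)]) auto
    also have "\<dots> = exp (e + ((\<integral>\<sigma>. f \<sigma> \<partial>\<mu>) + C / 2 * (\<Sum>x\<in>\<Lambda>. (osc x f)\<^sup>2)))"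
      by (simp add: exp_add)
    finally have "ln (\<integral>\<sigma>. exp (g \<sigma>) \<partial>\<mu>) \<le> e + ((\<integral>\<sigma>. f \<sigma> \<partial>\<mu>) + C / 2 * (\<Sum>x\<in>\<Lambda>. (osc x f)\<^sup>2))"
      using integral_exp_pos[OF \<mu> g] by (metis ln_exp ln_le_cancel_iff exp_gt_zero)
    also have "\<dots> \<le> e + (((\<integral>\<sigma>. g \<sigma> \<partial>\<mu>) + e) + C / 2 * K)"
      using mean sum GCB_nonneg[OF GCB] by (intro add_mono mult_left_mono) auto
    finally show "ln (\<integral>\<sigma>. exp (g \<sigma>) \<partial>\<mu>) \<le> (\<integral>\<sigma>. g \<sigma> \<partial>\<mu>) + C / 2 * K + e'"
      by (simp add: e_def)
  qed
  thus ?thesis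
    using integral_exp_pos[OF \<mu> g] by (metis exp_le_cancel_iff exp_ln)
qed

text \<open>Hoeffding's 1/8 per site is \<open>C / 2\<close> with \<open>C = 1/4\<close>.\<close>

lemma product_measure_GCB:
  fixes \<pi> :: "'d::finite config measure"
  assumes "product_measure \<pi>"
  shows "GCB (1/4) \<pi>"
proof -
  from assms obtain M where all: "\<forall>x. prob_space (M x) \<and> sets (M x) = sets (count_space {-1, 1})"
    and \<pi>: "\<pi> = PiM UNIV M"
    unfolding product_measure_def by (elim exE conjE)
  have M: "\<And>x. prob_space (M x)" "\<And>x. sets (M x) = sets (count_space {-1, 1})"
    using all by simp_all
  have "(\<integral>\<sigma>. exp (f \<sigma>) \<partial>\<pi>) \<le> exp ((\<integral>\<sigma>. f \<sigma> \<partial>\<pi>) + 1/4 / 2 * (\<Sum>x\<in>\<Lambda>. (osc x f)\<^sup>2))"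
    if fin: "finite \<Lambda>" and f: "depends_on \<Lambda> f" for \<Lambda> f
  proof -
    obtain xs where xs: "\<Lambda> = set xs" "distinct xs" using finite_distinct_list[OF fin] by metis
    note eq = integral_PiM_eq_avg[OF M _ one_in_Omega_S, of xs]
    show ?thesis
      unfolding \<pi> eq[OF depends_on_compose[OF f[unfolded xs], where h = exp]] eq[OF f[unfolded xs]]
      using avg_exp_le[OF measure_M_in[OF M] fin f one_in_Omega_S, where xs = xs] xs
      by (simp add: sum_list_distinct_conv_sum_set)
  qed
  with PiM_in_prob_measures[OF M] show ?thesis
    unfolding \<pi> by (rule GCBI)
qed

section \<open>One step and n steps of the dynamics\<close>

context
  fixes r :: "(int ^ 'd::finite) set \<Rightarrow> real" and S :: real
  assumes pca: "pca r"
    and S: "\<And>Z. finite Z \<Longrightarrow> sum (influence r) Z \<le> S"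
begin

lemma sum_osc_pca_op:
  assumes "finite \<Lambda>" "depends_on \<Lambda> f" "finite Y"
  shows "(\<Sum>y\<in>Y. osc y (pca_op r f)) \<le> S * (\<Sum>x\<in>\<Lambda>. osc x f)"
proof -
  have "(\<Sum>y\<in>Y. osc y (pca_op r f)) \<le> (\<Sum>y\<in>Y. \<Sum>x\<in>\<Lambda>. influence r (y - x) * osc x f)"
    by (intro sum_mono osc_pca_op_le[OF pca assms(1,2)])
  also have "\<dots> \<le> S * (\<Sum>x\<in>\<Lambda>. osc x f)"
    by (rule Young_l1[OF S osc_nonneg[OF depends_on_continuous_on[OF assms(1,2)]] assms(3,1)])
  finally show ?thesis .
qed

lemma sum_osc_squared_pca_op:
  assumes "finite \<Lambda>" "depends_on \<Lambda> f" "finite Y"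
  shows "(\<Sum>y\<in>Y. (osc y (pca_op r f))\<^sup>2) \<le> S\<^sup>2 * (\<Sum>x\<in>\<Lambda>. (osc x f)\<^sup>2)"
proof -
  have "(\<Sum>y\<in>Y. (osc y (pca_op r f))\<^sup>2) \<le> (\<Sum>y\<in>Y. (\<Sum>x\<in>\<Lambda>. influence r (y - x) * osc x f)\<^sup>2)"
    by (intro sum_mono power_mono osc_pca_op_le[OF pca assms(1,2)] osc_nonneg
        continuous_on_pca_op[OF pca assms(1,2)])
  also have "\<dots> \<le> S\<^sup>2 * (\<Sum>x\<in>\<Lambda>. (osc x f)\<^sup>2)"
    by (rule Young_l2[OF S influence_nonneg[OF pca] assms(3,1)])
  finally show ?thesis .
qed

text \<open>Condition on the previous configuration. The kernel is a product measure, so the inner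
  bound with \<open>c\<close> is uniform in \<open>\<eta>\<close>; what remains is the fluctuation
  of the conditional mean \<open>pca_op r f\<close> under \<open>\<mu>\<close>, paid with
  \<open>C * S\<^sup>2\<close>. The exponents add.\<close>

lemma GCB_pca_push:
  assumes c: "\<And>\<pi> :: 'd config measure. product_measure \<pi> \<Longrightarrow> GCB c \<pi>" and GCB: "GCB C \<mu>"
  shows "GCB (c + C * S\<^sup>2) (pca_push r \<mu>)"
proof -
  have \<mu>: "\<mu> \<in> prob_measures_on_Omega" using GCB by (simp add: GCB_def)
  have "(\<integral>\<sigma>. exp (f \<sigma>) \<partial>pca_push r \<mu>)
      \<le> exp ((\<integral>\<sigma>. f \<sigma> \<partial>pca_push r \<mu>) + (c + C * S\<^sup>2) / 2 * (\<Sum>x\<in>\<Lambda>. (osc x f)\<^sup>2))"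
    if f: "finite \<Lambda>" "depends_on \<Lambda> f" for \<Lambda> f
  proof -
    let ?V = "\<Sum>x\<in>\<Lambda>. (osc x f)\<^sup>2"
    have cont: "continuous_on Omega_S f" by (rule depends_on_continuous_on[OF f])
    have contP: "continuous_on Omega_S (pca_op r f)" by (rule continuous_on_pca_op[OF pca f])
    have exp_f: "depends_on \<Lambda> (\<lambda>\<sigma>. exp (f \<sigma>))" by (rule depends_on_compose[OF f(2)])
    have "pca_op r (\<lambda>\<sigma>. exp (f \<sigma>)) \<eta> \<le> exp (c / 2 * ?V) * exp (pca_op r f \<eta>)" if "\<eta> \<in> Omega_S" for \<eta>
      using GCBD[OF c[OF product_measure_pca_kernel[OF pca that]] f]
      unfolding pca_op_def exp_add[symmetric] by (simp add: add.commute)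
    hence "(\<integral>\<sigma>. exp (f \<sigma>) \<partial>pca_push r \<mu>) \<le> (\<integral>\<eta>. exp (c / 2 * ?V) * exp (pca_op r f \<eta>) \<partial>\<mu>)"
      unfolding integral_pca_push[OF pca \<mu> depends_on_continuous_on[OF f(1) exp_f]]
      by (intro integral_mono continuous_on_integrable[OF \<mu>] continuous_intros contP
            continuous_on_pca_op[OF pca f(1) exp_f])
         (auto simp: prob_measures_on_OmegaD(3)[OF \<mu>])
    also have "\<dots> = exp (c / 2 * ?V) * (\<integral>\<eta>. exp (pca_op r f \<eta>) \<partial>\<mu>)" by simp
    also have "\<dots> \<le> exp (c / 2 * ?V) * exp ((\<integral>\<eta>. pca_op r f \<eta> \<partial>\<mu>) + C / 2 * (S\<^sup>2 * ?V))"
      by (intro mult_left_mono GCB_continuous[OF GCB contP] sum_osc_squared_pca_op[OF f]) auto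
    also have "\<dots> = exp ((\<integral>\<sigma>. f \<sigma> \<partial>pca_push r \<mu>) + (c + C * S\<^sup>2) / 2 * ?V)"
      unfolding integral_pca_push[OF pca \<mu> cont] exp_add[symmetric]
      by (simp add: add_divide_distrib algebra_simps)
    finally show ?thesis .
  qed
  with pca_push_in[OF pca \<mu>] show ?thesis by (rule GCBI)
qed

text \<open>Unrolls the affine recursion that sends \<open>C\<close> to
  \<open>c + C * S\<^sup>2\<close>. Leaving the geometric sum unevaluated treats \<kappa> = 1
  together with the other values.\<close>

lemma GCB_pca_push_iterate:
  assumes c: "\<And>\<pi> :: 'd config measure. product_measure \<pi> \<Longrightarrow> GCB c \<pi>" and GCB: "GCB C \<mu>"
  shows "GCB (c * (\<Sum>k<n. (S\<^sup>2) ^ k) + C * (S\<^sup>2) ^ n) ((pca_push r ^^ n) \<mu>)"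
proof (induction n)
  case (Suc n)
  have "c + (c * (\<Sum>k<n. (S\<^sup>2) ^ k) + C * (S\<^sup>2) ^ n) * S\<^sup>2 = c * (\<Sum>k<Suc n. (S\<^sup>2) ^ k) + C * (S\<^sup>2) ^ Suc n"
    unfolding sum.lessThan_Suc_shift by (simp add: algebra_simps sum_distrib_left)
  with GCB_pca_push[OF c Suc.IH] show ?case by simp
qed (use GCB in simp)

end

section \<open>Limits of measures\<close>

text \<open>Indicator of a cylinder, as a product of one-site factors so that
  \<open>depends_on_prod\<close> covers it.\<close>

definition cyl :: "(int ^ 'd::finite) set \<Rightarrow> 'd config \<Rightarrow> 'd config \<Rightarrow> real" where
  "cyl J \<tau> \<sigma> = (\<Prod>x\<in>J. of_bool (\<sigma> x = \<tau> x))"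

lemma depends_on_prod: "depends_on J (\<lambda>\<sigma>. \<Prod>x\<in>J. g x (\<sigma> x))"
  by (simp add: depends_on_def cong: prod.cong)

lemma depends_on_cyl: "depends_on J (cyl J \<tau>)"
  unfolding cyl_def by (rule depends_on_prod)

lemma cyl_eq: "finite J \<Longrightarrow> cyl J \<tau> \<sigma> = of_bool (\<forall>x\<in>J. \<sigma> x = \<tau> x)"
  unfolding cyl_def by (induction J rule: finite_induct) auto

lemma continuous_on_cyl: "finite J \<Longrightarrow> continuous_on Omega_S (cyl J \<tau>)"
  by (rule depends_on_continuous_on[OF _ depends_on_cyl])

text \<open>Exactly one pattern \<open>\<tau>\<close> on \<open>J\<close> matches
  \<open>\<sigma>\<close>. A pattern is undefined off \<open>J\<close>; \<open>clamp\<close>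
  completes it to a configuration at which f can be evaluated.\<close>

lemma local_expansion:
  assumes J: "finite J" and f: "depends_on J f" and \<sigma>: "\<sigma> \<in> Omega_S"
  shows "f \<sigma> = (\<Sum>\<tau>\<in>(\<Pi>\<^sub>E x\<in>J. {-1, 1}). f (clamp J \<tau>) * cyl J \<tau> \<sigma>)"
proof -
  have "cyl J \<tau> \<sigma> = of_bool (\<tau> = restrict \<sigma> J)" if "\<tau> \<in> (\<Pi>\<^sub>E x\<in>J. {-1, 1})" for \<tau>
  proof -
    have "(\<forall>x\<in>J. \<sigma> x = \<tau> x) \<longleftrightarrow> \<tau> = restrict \<sigma> J"
      using that by (auto simp: PiE_def extensional_def restrict_def fun_eq_iff)
    thus ?thesis using J by (simp add: cyl_eq)
  qed
  hence "(\<Sum>\<tau>\<in>(\<Pi>\<^sub>E x\<in>J. {-1, 1}). f (clamp J \<tau>) * cyl J \<tau> \<sigma>)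
      = (\<Sum>\<tau>\<in>(\<Pi>\<^sub>E x\<in>J. {-1, 1}). if \<tau> = restrict \<sigma> J then f (clamp J \<tau>) else 0)"
    by (intro sum.cong) auto
  also have "\<dots> = f (clamp J (restrict \<sigma> J))"
    using J \<sigma> by (subst sum.delta) (auto intro!: finite_PiE simp: Omega_S_def)
  also have "clamp J (restrict \<sigma> J) = clamp J \<sigma>"
    by (simp add: clamp_def fun_eq_iff)
  also have "f (clamp J \<sigma>) = f \<sigma>"
    by (rule depends_onD[OF f clamp_in_Omega_S[OF \<sigma>] \<sigma>]) (simp add: clamp_def)
  finally show ?thesis ..
qed

lemma integral_local_expansion:
  assumes \<mu>: "\<mu> \<in> prob_measures_on_Omega" and J: "finite J" and f: "depends_on J f"
  shows "integral\<^sup>L \<mu> f = (\<Sum>\<tau>\<in>(\<Pi>\<^sub>E x\<in>J. {-1, 1}). f (clamp J \<tau>) * integral\<^sup>L \<mu> (cyl J \<tau>))"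
proof -
  have "integral\<^sup>L \<mu> f = (\<integral>\<sigma>. (\<Sum>\<tau>\<in>(\<Pi>\<^sub>E x\<in>J. {-1, 1}). f (clamp J \<tau>) * cyl J \<tau> \<sigma>) \<partial>\<mu>)"
    using local_expansion[OF J f] prob_measures_on_OmegaD(3)[OF \<mu>]
    by (intro Bochner_Integration.integral_cong) auto
  thus ?thesis
    using continuous_on_integrable[OF \<mu> continuous_on_cyl[OF J]] by simp
qed

text \<open>Indicators of cylinder sets are products of one-site functions, and these sets determine
  a measure. Product form is also what the non-interacting kernel preserves.\<close>

lemma measure_eqI_local:
  fixes \<mu> \<nu> :: "'d::finite config measure"
  assumes \<mu>: "\<mu> \<in> prob_measures_on_Omega" and \<nu>: "\<nu> \<in> prob_measures_on_Omega"
    and eq: "\<And>J (g :: int ^ 'd \<Rightarrow> real \<Rightarrow> real). finite J \<Longrightarrow> (\<integral>\<sigma>. (\<Prod>x\<in>J. g x (\<sigma> x)) \<partial>\<mu>) = (\<integral>\<sigma>. (\<Prod>x\<in>J. g x (\<sigma> x)) \<partial>\<nu>)"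
  shows "\<mu> = \<nu>"
proof -
  let ?C = "\<lambda>_ :: int ^ 'd. count_space {-1, 1 :: real}"
  interpret \<mu>: prob_space \<mu> by (rule prob_measures_on_OmegaD[OF \<mu>])
  interpret \<nu>: prob_space \<nu> by (rule prob_measures_on_OmegaD[OF \<nu>])
  show ?thesis
  proof (rule measure_eqI_PiM_infinite)
    show sets: "sets \<mu> = sets (PiM UNIV ?C)" "sets \<nu> = sets (PiM UNIV ?C)"
      using prob_measures_on_OmegaD(2)[OF \<mu>] prob_measures_on_OmegaD(2)[OF \<nu>]
      by (simp_all add: sets_Omega_S_eq_PiM)
    show "finite_measure \<mu>" by (rule \<mu>.finite_measure_axioms)
    fix E and J :: "(int ^ 'd) set"
    assume J: "finite J" and E: "\<And>j. j \<in> J \<Longrightarrow> E j \<in> sets (?C j)"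
    let ?X = "prod_emb UNIV ?C J (Pi\<^sub>E J E)"
    have X: "?X \<in> sets (PiM UNIV ?C)" using J E by (intro sets_PiM_I) auto
    have "measure \<rho> ?X = (\<integral>\<sigma>. (\<Prod>x\<in>J. indicator (E x) (\<sigma> x)) \<partial>\<rho>)"
      if \<rho>: "\<rho> \<in> prob_measures_on_Omega" "sets \<rho> = sets (PiM UNIV ?C)" for \<rho>
    proof -
      have "(\<integral>\<sigma>. (\<Prod>x\<in>J. indicator (E x) (\<sigma> x)) \<partial>\<rho>) = integral\<^sup>L \<rho> (indicator ?X :: _ \<Rightarrow> real)"
      proof (rule Bochner_Integration.integral_cong[OF refl])
        fix \<sigma> assume "\<sigma> \<in> space \<rho>"
        hence "\<sigma> \<in> ?X \<longleftrightarrow> (\<forall>x\<in>J. \<sigma> x \<in> E x)"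
          using prob_measures_on_OmegaD(3)[OF \<rho>(1)]
          by (auto simp: prod_emb_def PiE_iff Omega_S_def)
        thus "(\<Prod>x\<in>J. indicator (E x) (\<sigma> x)) = (indicator ?X \<sigma> :: real)"
          using J by (auto simp: indicator_def)
      qed
      also have "\<dots> = measure \<rho> ?X"
        using X \<rho>(2) sets.sets_into_space[of ?X \<rho>] by (simp add: Int_absorb2)
      finally show ?thesis ..
    qed
    hence "measure \<mu> ?X = measure \<nu> ?X"
      using \<mu> \<nu> sets eq[OF J, of "\<lambda>x. indicator (E x)"] by simp
    thus "emeasure \<mu> ?X = emeasure \<nu> ?X"
      by (simp add: \<mu>.emeasure_eq_measure \<nu>.emeasure_eq_measure)
  qed
qed

text \<open>A finite-dimensional marginal of the limit is a finite sum of point masses; by Kolmogorov's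
  extension theorem these marginals come from a measure on all real configurations, which is
  mapped to \<^const>\<open>Omega_S\<close> by sending every value other than 1 to -1.\<close>

lemma limit_measure_exists:
  fixes \<mu>s :: "nat \<Rightarrow> 'd::finite config measure"
  assumes \<mu>s: "\<And>n. \<mu>s n \<in> prob_measures_on_Omega"
    and conv: "\<And>\<Lambda> f. finite \<Lambda> \<Longrightarrow> depends_on \<Lambda> f \<Longrightarrow> convergent (\<lambda>n. integral\<^sup>L (\<mu>s n) f)"
  shows "\<exists>\<nu>\<in>prob_measures_on_Omega. \<forall>\<Lambda> f. finite \<Lambda> \<longrightarrow> depends_on \<Lambda> f \<longrightarrow>
    (\<lambda>n. integral\<^sup>L (\<mu>s n) f) \<longlonglongrightarrow> integral\<^sup>L \<nu> f"
proof -
  \<comment> \<open>On local functions \<open>L\<close> is what the integral against the limit has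
    to be; the measure is rebuilt from its values on cylinders.\<close>
  define L :: "('d config \<Rightarrow> real) \<Rightarrow> real" where "L f = lim (\<lambda>n. integral\<^sup>L (\<mu>s n) f)" for f
  define D :: "(int ^ 'd) set \<Rightarrow> 'd config set" where "D J = (\<Pi>\<^sub>E x\<in>J. {-1, 1})" for J
  define T :: "'d config \<Rightarrow> 'd config" where "T \<omega> = (\<lambda>x. if \<omega> x = 1 then 1 else -1)" for \<omega>
  have fin_D: "finite (D J)" if "finite J" for J
    unfolding D_def using that by (intro finite_PiE) auto
  have L: "(\<lambda>n. integral\<^sup>L (\<mu>s n) f) \<longlonglongrightarrow> L f" if "finite \<Lambda>" "depends_on \<Lambda> f" for \<Lambda> f
    using conv[OF that] unfolding L_def by (simp add: convergent_LIMSEQ_iff)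
  have L_cong: "L f = L g" if "\<And>\<sigma>. \<sigma> \<in> Omega_S \<Longrightarrow> f \<sigma> = g \<sigma>" for f g
  proof -
    have "integral\<^sup>L (\<mu>s n) f = integral\<^sup>L (\<mu>s n) g" for n
      using that prob_measures_on_OmegaD(3)[OF \<mu>s] by (intro Bochner_Integration.integral_cong) auto
    thus ?thesis by (simp add: L_def)
  qed
  have L_cyl_nonneg: "0 \<le> L (cyl J \<tau>)" if "finite J" for J \<tau>
    by (rule LIMSEQ_le_const[OF L[OF that depends_on_cyl]])
       (auto intro!: exI[of _ 0] Bochner_Integration.integral_nonneg simp: cyl_eq[OF that])
  have L_expand: "L f = (\<Sum>\<tau>\<in>D J. f (clamp J \<tau>) * L (cyl J \<tau>))" if "finite J" "depends_on J f" for J f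
  proof (rule LIMSEQ_unique)
    show "(\<lambda>n. integral\<^sup>L (\<mu>s n) f) \<longlonglongrightarrow> L f" by (rule L[OF that])
    show "(\<lambda>n. integral\<^sup>L (\<mu>s n) f) \<longlonglongrightarrow> (\<Sum>\<tau>\<in>D J. f (clamp J \<tau>) * L (cyl J \<tau>))"
      unfolding integral_local_expansion[OF \<mu>s that] D_def
      by (intro tendsto_intros L[OF that(1) depends_on_cyl])
  qed
  have restrict_dep: "depends_on J (\<lambda>\<sigma>. of_bool (restrict \<sigma> J \<in> A))" for J A
    unfolding depends_on_def
    by (intro ballI impI arg_cong[of _ _ "\<lambda>\<tau>. of_bool (\<tau> \<in> A)"] restrict_ext) blast

  \<comment> \<open>The masses sit on finitely many patterns; transporting them to a product of
    Borel lines puts the family in the setting of \<open>polish_projective\<close>.\<close>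
  define P where "P J = distr (point_measure (D J) (\<lambda>\<tau>. ennreal (L (cyl J \<tau>))))
                           (PiM J (\<lambda>_. borel :: real measure)) (\<lambda>\<tau>. \<tau>)" for J
  have sets_P: "sets (P J) = sets (PiM J (\<lambda>_. borel))" for J by (simp add: P_def)
  have P: "emeasure (P J) A = ennreal (L (\<lambda>\<sigma>. of_bool (restrict \<sigma> J \<in> A)))"
    if J: "finite J" and A: "A \<in> sets (PiM J (\<lambda>_. borel))" for J A
  proof -
    have "emeasure (P J) A = emeasure (point_measure (D J) (\<lambda>\<tau>. ennreal (L (cyl J \<tau>)))) (A \<inter> D J)"
      unfolding P_def using A
      by (subst emeasure_distr) (auto simp: space_point_measure D_def space_PiM PiE_def)
    also have "\<dots> = (\<Sum>\<tau>\<in>A \<inter> D J. ennreal (L (cyl J \<tau>)))"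
      using fin_D[OF J] by (intro emeasure_point_measure_finite) auto
    also have "\<dots> = ennreal (\<Sum>\<tau>\<in>A \<inter> D J. L (cyl J \<tau>))"
      by (intro sum_ennreal L_cyl_nonneg J)
    also have "(\<Sum>\<tau>\<in>A \<inter> D J. L (cyl J \<tau>)) = (\<Sum>\<tau>\<in>D J. of_bool (\<tau> \<in> A) * L (cyl J \<tau>))"
      using fin_D[OF J] by (intro sum.mono_neutral_cong_left) auto
    also have "\<dots> = (\<Sum>\<tau>\<in>D J. of_bool (restrict (clamp J \<tau>) J \<in> A) * L (cyl J \<tau>))"
    proof (rule sum.cong[OF refl])
      fix \<tau> assume "\<tau> \<in> D J"
      hence "restrict (clamp J \<tau>) J = \<tau>"
        by (auto simp: D_def PiE_def extensional_def restrict_def clamp_def fun_eq_iff)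
      thus "of_bool (\<tau> \<in> A) * L (cyl J \<tau>) = of_bool (restrict (clamp J \<tau>) J \<in> A) * L (cyl J \<tau>)"
        by simp
    qed
    also have "\<dots> = L (\<lambda>\<sigma>. of_bool (restrict \<sigma> J \<in> A))"
      by (rule L_expand[OF J restrict_dep, symmetric])
    finally show ?thesis .
  qed

  have "projective_family UNIV P (\<lambda>_. borel)"
  proof (rule projective_family.intro)
    fix J H :: "(int ^ 'd) set" assume JH: "J \<subseteq> H" "finite H"
    hence J: "finite J" by (rule finite_subset)
    have meas: "(\<lambda>f. restrict f J) \<in> P H \<rightarrow>\<^sub>M PiM J (\<lambda>_. borel :: real measure)"
      unfolding measurable_cong_sets[OF sets_P refl]
      by (rule measurable_restrict_subset[OF JH(1)])
    show "P J = distr (P H) (PiM J (\<lambda>_. borel)) (\<lambda>f. restrict f J)"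
    proof (rule measure_eqI)
      fix A assume "A \<in> sets (P J)"
      hence A: "A \<in> sets (PiM J (\<lambda>_. borel :: real measure))" by (simp add: sets_P)
      let ?B = "(\<lambda>f. restrict f J) -` A \<inter> space (P H)"
      have B: "?B \<in> sets (PiM H (\<lambda>_. borel :: real measure))"
        using measurable_sets[OF meas A] by (simp add: sets_P)
      \<comment> \<open>Consistency: the two masses are \<open>L\<close> of the same local
        function.\<close>
      have "restrict \<sigma> H \<in> ?B \<longleftrightarrow> restrict \<sigma> J \<in> A" for \<sigma>
        using JH(1) sets_eq_imp_space_eq[OF sets_P, of H]
        by (simp add: space_PiM Int_absorb1)
      thus "emeasure (P J) A = emeasure (distr (P H) (PiM J (\<lambda>_. borel)) (\<lambda>f. restrict f J)) A"
        unfolding emeasure_distr[OF meas A] P[OF J A] P[OF JH(2) B] by simp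
    qed (simp add: sets_P)
  next
    fix J :: "(int ^ 'd) set" assume J: "finite J"
    interpret \<mu>: prob_space "\<mu>s n" for n by (rule prob_measures_on_OmegaD[OF \<mu>s])
    have "L (\<lambda>\<sigma>. of_bool (restrict \<sigma> J \<in> space (P J))) = L (\<lambda>_. 1)"
      using sets_eq_imp_space_eq[OF sets_P, of J] by (intro L_cong) (simp add: space_PiM)
    also have "\<dots> = 1" by (simp add: L_def \<mu>.prob_space)
    finally show "prob_space (P J)"
      using P[OF J, of "space (P J)"] sets_eq_imp_space_eq[OF sets_P, of J]
      by (intro prob_spaceI) simp
  qed
  then interpret lim: polish_projective UNIV P
    by (rule polish_projective.intro)

  have "(\<lambda>\<omega>. T \<omega>) \<in> PiM UNIV (\<lambda>_. borel) \<rightarrow>\<^sub>M PiM UNIV (\<lambda>_. borel)"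
    unfolding T_def by (rule measurable_PiM_single') auto
  hence "T \<in> PiM UNIV (\<lambda>_. borel) \<rightarrow>\<^sub>M borel"
    by (simp cong: measurable_cong_sets add: sets_PiM_equal_borel)
  hence T: "T \<in> lim.lim \<rightarrow>\<^sub>M restrict_space borel Omega_S"
    by (intro measurable_restrict_space2)
       (auto simp: T_def Omega_S_def measurable_cong_sets[OF lim.sets_lim refl])
  define \<nu> where "\<nu> = distr lim.lim (restrict_space borel Omega_S) T"
  have \<nu>: "\<nu> \<in> prob_measures_on_Omega"
    unfolding prob_measures_on_Omega_def \<nu>_def
    using lim.P.prob_space_distr[OF T] by simp

  have \<nu>_cyl: "integral\<^sup>L \<nu> (cyl J \<tau>) = L (cyl J \<tau>)" if J: "finite J" for J \<tau>
  proof -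
    \<comment> \<open>The preimage of the cylinder under \<open>T\<close>: where
      \<open>\<tau>\<close> is -1, every real other than 1 qualifies.\<close>
    define X where "X = (\<Pi>\<^sub>E x\<in>J. {s :: real. (if s = 1 then 1 else -1) = \<tau> x})"
    have X: "X \<in> sets (PiM J (\<lambda>_. borel))"
      unfolding X_def by (intro sets_PiM_I_finite J) measurable
    have meas: "cyl J \<tau> \<in> borel_measurable (restrict_space borel Omega_S)"
      by (rule continuous_on_measurable[OF refl continuous_on_cyl[OF J]])
    have "integral\<^sup>L \<nu> (cyl J \<tau>) = (\<integral>\<omega>. cyl J \<tau> (T \<omega>) \<partial>lim.lim)"
      unfolding \<nu>_def by (rule integral_distr[OF T meas])
    also have "\<dots> = integral\<^sup>L lim.lim (indicator (lim.emb UNIV J X))"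
      by (intro Bochner_Integration.integral_cong refl)
         (auto simp: cyl_eq[OF J] indicator_def prod_emb_def X_def T_def PiE_iff)
    also have "\<dots> = measure (P J) X"
      using lim.measure_lim_emb[OF subset_UNIV J X] by (simp add: prod_emb_def space_PiM)
    also have "\<dots> = L (cyl J \<tau>)"
    proof -
      have "L (\<lambda>\<sigma>. of_bool (restrict \<sigma> J \<in> X)) = L (cyl J \<tau>)"
      proof (rule L_cong)
        fix \<sigma> :: "'d config" assume "\<sigma> \<in> Omega_S"
        hence "(if \<sigma> x = 1 then 1 else -1) = \<sigma> x" for x using Omega_S_cases[of \<sigma> x] by auto
        thus "of_bool (restrict \<sigma> J \<in> X) = cyl J \<tau> \<sigma>"
          by (simp add: X_def cyl_eq[OF J] PiE_iff)
      qed
      thus ?thesis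
        unfolding measure_def P[OF J X] using L_cyl_nonneg[OF J] by simp
    qed
    finally show ?thesis .
  qed
  show ?thesis
  proof (intro bexI[OF _ \<nu>] allI impI)
    fix \<Lambda> and f :: "'d config \<Rightarrow> real" assume f: "finite \<Lambda>" "depends_on \<Lambda> f"
    have "integral\<^sup>L \<nu> f = L f"
      unfolding integral_local_expansion[OF \<nu> f] L_expand[OF f] \<nu>_cyl[OF f(1)] D_def ..
    thus "(\<lambda>n. integral\<^sup>L (\<mu>s n) f) \<longlonglongrightarrow> integral\<^sup>L \<nu> f" using L[OF f] by simp
  qed
qed

section \<open>Ergodicity\<close>

text \<open>\<open>K\<close> bounds the distance of the two measures dual to the seminorm given by
  the sum of oscillations, the usual one for interacting particle systems.\<close>

definition osc_close :: "real \<Rightarrow> 'd::finite config measure \<Rightarrow> 'd config measure \<Rightarrow> bool" where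
  "osc_close K \<mu> \<nu> \<longleftrightarrow> (\<forall>\<Lambda> f. finite \<Lambda> \<longrightarrow> depends_on \<Lambda> f \<longrightarrow>
     \<bar>integral\<^sup>L \<mu> f - integral\<^sup>L \<nu> f\<bar> \<le> K * (\<Sum>x\<in>\<Lambda>. osc x f))"

lemma osc_closeI:
  assumes "\<And>\<Lambda> f. finite \<Lambda> \<Longrightarrow> depends_on \<Lambda> f \<Longrightarrow>
     \<bar>integral\<^sup>L \<mu> f - integral\<^sup>L \<nu> f\<bar> \<le> K * (\<Sum>x\<in>\<Lambda>. osc x f)"
  shows "osc_close K \<mu> \<nu>"
  using assms by (simp add: osc_close_def)

lemma osc_closeD:
  assumes "osc_close K \<mu> \<nu>" "finite \<Lambda>" "depends_on \<Lambda> f"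
  shows "\<bar>integral\<^sup>L \<mu> f - integral\<^sup>L \<nu> f\<bar> \<le> K * (\<Sum>x\<in>\<Lambda>. osc x f)"
  using assms by (simp add: osc_close_def)

lemma abs_integral_diff_le:
  fixes f g :: "'d::finite config \<Rightarrow> real"
  assumes \<mu>: "\<mu> \<in> prob_measures_on_Omega"
    and f: "continuous_on Omega_S f" and g: "continuous_on Omega_S g"
    and le: "\<And>\<sigma>. \<sigma> \<in> Omega_S \<Longrightarrow> \<bar>f \<sigma> - g \<sigma>\<bar> \<le> e"
  shows "\<bar>integral\<^sup>L \<mu> f - integral\<^sup>L \<mu> g\<bar> \<le> e"
proof -
  interpret prob_space \<mu> by (rule prob_measures_on_OmegaD[OF \<mu>])
  note int = continuous_on_integrable[OF \<mu>]
  have "\<bar>\<integral>\<sigma>. f \<sigma> - g \<sigma> \<partial>\<mu>\<bar> \<le> (\<integral>\<sigma>. \<bar>f \<sigma> - g \<sigma>\<bar> \<partial>\<mu>)"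
    by (rule integral_abs_bound)
  also have "\<dots> \<le> (\<integral>\<sigma>. e \<partial>\<mu>)"
    using le by (intro integral_mono int continuous_intros f g) (auto simp: prob_measures_on_OmegaD(3)[OF \<mu>])
  finally show ?thesis using int[OF f] int[OF g] by (simp add: prob_space)
qed

text \<open>Start of the induction: each integral lies within one total oscillation of the value at
  the all-plus configuration, whence the 2.\<close>

lemma osc_close_2:
  fixes \<mu> \<nu> :: "'d::finite config measure"
  assumes \<mu>: "\<mu> \<in> prob_measures_on_Omega" and \<nu>: "\<nu> \<in> prob_measures_on_Omega"
  shows "osc_close 2 \<mu> \<nu>"
proof (rule osc_closeI)
  fix \<Lambda> and f :: "'d config \<Rightarrow> real" assume f: "finite \<Lambda>" "depends_on \<Lambda> f"
  have *: "\<bar>integral\<^sup>L \<rho> f - integral\<^sup>L \<rho> (\<lambda>_. f (\<lambda>_. 1))\<bar> \<le> (\<Sum>x\<in>\<Lambda>. osc x f)"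
    if \<rho>: "\<rho> \<in> prob_measures_on_Omega" for \<rho>
    by (intro abs_integral_diff_le[OF \<rho>] depends_on_continuous_on[OF f] continuous_on_const
          depends_on_diff_le[OF f] one_in_Omega_S)
  interpret \<mu>: prob_space \<mu> by (rule prob_measures_on_OmegaD[OF \<mu>])
  interpret \<nu>: prob_space \<nu> by (rule prob_measures_on_OmegaD[OF \<nu>])
  show "\<bar>integral\<^sup>L \<mu> f - integral\<^sup>L \<nu> f\<bar> \<le> 2 * (\<Sum>x\<in>\<Lambda>. osc x f)"
    using *[OF \<mu>] *[OF \<nu>] by (simp add: \<mu>.prob_space \<nu>.prob_space)
qed

text \<open>Carries the dual bound from local functions to \<open>pca_op r f\<close>, which need not
  be local.\<close>

lemma osc_close_continuous:
  fixes g :: "'d::finite config \<Rightarrow> real"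
  assumes \<mu>: "\<mu> \<in> prob_measures_on_Omega" and \<nu>: "\<nu> \<in> prob_measures_on_Omega"
    and close: "osc_close K \<mu> \<nu>" and K: "0 \<le> K"
    and g: "continuous_on Omega_S g" and V: "\<And>Y. finite Y \<Longrightarrow> (\<Sum>y\<in>Y. osc y g) \<le> V"
  shows "\<bar>integral\<^sup>L \<mu> g - integral\<^sup>L \<nu> g\<bar> \<le> K * V"
proof (rule field_le_epsilon)
  fix e :: real assume "e > 0"
  hence "e / 2 > 0" by simp
  with local_approximation[OF g] obtain \<Lambda> f where f: "finite \<Lambda>" "depends_on \<Lambda> f"
    "\<And>\<sigma>. \<sigma> \<in> Omega_S \<Longrightarrow> \<bar>f \<sigma> - g \<sigma>\<bar> \<le> e / 2" "\<And>x. osc x f \<le> osc x g" by metis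
  have cont: "continuous_on Omega_S f" by (rule depends_on_continuous_on[OF f(1,2)])
  have "\<bar>integral\<^sup>L \<mu> f - integral\<^sup>L \<nu> f\<bar> \<le> K * (\<Sum>x\<in>\<Lambda>. osc x f)"
    by (rule osc_closeD[OF close f(1,2)])
  also have "\<dots> \<le> K * (\<Sum>x\<in>\<Lambda>. osc x g)"
    by (intro mult_left_mono sum_mono f K)
  also have "\<dots> \<le> K * V" by (intro mult_left_mono V f K)
  finally show "\<bar>integral\<^sup>L \<mu> g - integral\<^sup>L \<nu> g\<bar> \<le> K * V + e"
    using abs_integral_diff_le[OF \<mu> cont g f(3)] abs_integral_diff_le[OF \<nu> cont g f(3)]
    by linarith
qed

lemma weakly_convergesI_local:
  fixes \<nu> :: "'d::finite config measure"
  assumes \<mu>s: "\<And>n. \<mu>s n \<in> prob_measures_on_Omega" and \<nu>: "\<nu> \<in> prob_measures_on_Omega"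
    and lim: "\<And>\<Lambda> f. finite \<Lambda> \<Longrightarrow> depends_on \<Lambda> f \<Longrightarrow> (\<lambda>n. integral\<^sup>L (\<mu>s n) f) \<longlonglongrightarrow> integral\<^sup>L \<nu> f"
  shows "weakly_converges \<mu>s \<nu>"
  unfolding weakly_converges_def
proof (intro allI impI LIMSEQ_I)
  fix g :: "'d config \<Rightarrow> real" and e :: real
  assume g: "continuous_on Omega_S g" and "0 < e"
  hence "e / 3 > 0" by simp
  with local_approximation[OF g] obtain \<Lambda> f where f: "finite \<Lambda>" "depends_on \<Lambda> f"
    "\<And>\<sigma>. \<sigma> \<in> Omega_S \<Longrightarrow> \<bar>f \<sigma> - g \<sigma>\<bar> \<le> e / 3" by metis
  have cont: "continuous_on Omega_S f" by (rule depends_on_continuous_on[OF f(1,2)])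
  obtain N where N: "\<And>n. n \<ge> N \<Longrightarrow> norm (integral\<^sup>L (\<mu>s n) f - integral\<^sup>L \<nu> f) < e / 3"
    using LIMSEQ_D[OF lim[OF f(1,2)] \<open>e / 3 > 0\<close>] by blast
  have "norm (integral\<^sup>L (\<mu>s n) g - integral\<^sup>L \<nu> g) < e" if "n \<ge> N" for n
    using N[OF that] abs_integral_diff_le[OF \<mu>s cont g f(3), of n] abs_integral_diff_le[OF \<nu> cont g f(3)]
    unfolding real_norm_def by linarith
  thus "\<exists>N. \<forall>n\<ge>N. norm ((\<integral>\<sigma>. g \<sigma> \<partial>\<mu>s n) - (\<integral>\<sigma>. g \<sigma> \<partial>\<nu>)) < e" by blast
qed

lemma weakly_convergesD:
  fixes f :: "'d::finite config \<Rightarrow> real"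
  assumes "weakly_converges \<mu>s \<nu>" "continuous_on Omega_S f"
  shows "(\<lambda>n. integral\<^sup>L (\<mu>s n) f) \<longlonglongrightarrow> integral\<^sup>L \<nu> f"
  using assms by (simp add: weakly_converges_def)

text \<open>For a fixed local f both f and exp f are continuous, so both sides of the inequality
  converge.\<close>

lemma GCB_limit:
  fixes \<nu> :: "'d::finite config measure"
  assumes GCB: "\<And>n. GCB (C n) (\<mu>s n)" and C: "C \<longlonglongrightarrow> C'"
    and \<nu>: "\<nu> \<in> prob_measures_on_Omega" and lim: "weakly_converges \<mu>s \<nu>"
  shows "GCB C' \<nu>"
proof (rule GCBI[OF \<nu>])
  fix \<Lambda> and f :: "'d config \<Rightarrow> real" assume f: "finite \<Lambda>" "depends_on \<Lambda> f"
  have cont: "continuous_on Omega_S f" by (rule depends_on_continuous_on[OF f])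
  note lim' = weakly_convergesD[OF lim]
  show "(\<integral>\<sigma>. exp (f \<sigma>) \<partial>\<nu>) \<le> exp ((\<integral>\<sigma>. f \<sigma> \<partial>\<nu>) + C' / 2 * (\<Sum>x\<in>\<Lambda>. (osc x f)\<^sup>2))"
  proof (rule LIMSEQ_le)
    show "(\<lambda>n. \<integral>\<sigma>. exp (f \<sigma>) \<partial>\<mu>s n) \<longlonglongrightarrow> (\<integral>\<sigma>. exp (f \<sigma>) \<partial>\<nu>)"
      by (intro lim' continuous_intros cont)
    show "(\<lambda>n. exp ((\<integral>\<sigma>. f \<sigma> \<partial>\<mu>s n) + C n / 2 * (\<Sum>x\<in>\<Lambda>. (osc x f)\<^sup>2)))
        \<longlonglongrightarrow> exp ((\<integral>\<sigma>. f \<sigma> \<partial>\<nu>) + C' / 2 * (\<Sum>x\<in>\<Lambda>. (osc x f)\<^sup>2))"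
      by (intro tendsto_intros lim' cont C) auto
  qed (use GCBD[OF GCB f] in blast)
qed

section \<open>Contraction and convergence to the stationary measure\<close>

context
  fixes r :: "(int ^ 'd::finite) set \<Rightarrow> real" and S :: real
  assumes pca: "pca r"
    and S: "\<And>Z. finite Z \<Longrightarrow> sum (influence r) Z \<le> S"
begin

lemma S_nonneg: "0 \<le> S"
  using S[of "{}"] by simp

lemma pca_push_iterate_in:
  "\<mu> \<in> prob_measures_on_Omega \<Longrightarrow> (pca_push r ^^ n) \<mu> \<in> prob_measures_on_Omega"
  by (induction n) (simp_all add: pca_push_in[OF pca])

lemma osc_close_pca_push:
  assumes \<mu>: "\<mu> \<in> prob_measures_on_Omega" and \<nu>: "\<nu> \<in> prob_measures_on_Omega"
    and close: "osc_close K \<mu> \<nu>" and K: "0 \<le> K"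
  shows "osc_close (K * S) (pca_push r \<mu>) (pca_push r \<nu>)"
proof (rule osc_closeI)
  fix \<Lambda> and f :: "'d config \<Rightarrow> real" assume f: "finite \<Lambda>" "depends_on \<Lambda> f"
  note cont = depends_on_continuous_on[OF f]
  have "\<bar>integral\<^sup>L \<mu> (pca_op r f) - integral\<^sup>L \<nu> (pca_op r f)\<bar> \<le> K * (S * (\<Sum>x\<in>\<Lambda>. osc x f))"
    by (rule osc_close_continuous[OF \<mu> \<nu> close K continuous_on_pca_op[OF pca f]
              sum_osc_pca_op[OF pca S f]])
  thus "\<bar>integral\<^sup>L (pca_push r \<mu>) f - integral\<^sup>L (pca_push r \<nu>) f\<bar> \<le> K * S * (\<Sum>x\<in>\<Lambda>. osc x f)"
    by (simp add: integral_pca_push[OF pca \<mu> cont] integral_pca_push[OF pca \<nu> cont] mult.assoc)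
qed

lemma osc_close_pca_push_iterate:
  assumes \<mu>: "\<mu> \<in> prob_measures_on_Omega" and \<nu>: "\<nu> \<in> prob_measures_on_Omega"
  shows "osc_close (2 * S ^ n) ((pca_push r ^^ n) \<mu>) ((pca_push r ^^ n) \<nu>)"
proof (induction n)
  case 0
  show ?case using osc_close_2[OF \<mu> \<nu>] by simp
next
  case (Suc n)
  have "osc_close (2 * S ^ n * S) (pca_push r ((pca_push r ^^ n) \<mu>)) (pca_push r ((pca_push r ^^ n) \<nu>))"
    using S_nonneg by (intro osc_close_pca_push pca_push_iterate_in \<mu> \<nu> Suc.IH) simp
  thus ?case by (simp add: mult_ac)
qed

text \<open>The contraction does three jobs: it makes one orbit Cauchy on local functions, attracts
  every other orbit to the limit, and so excludes a second stationary measure. Stationarity of the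
  limit comes from the Feller property.\<close>

lemma pca_ergodic:
  assumes S1: "S < 1"
  obtains \<nu> where "unique_stationary r \<nu>"
    "\<And>\<mu>. \<mu> \<in> prob_measures_on_Omega \<Longrightarrow> weakly_converges (\<lambda>n. (pca_push r ^^ n) \<mu>) \<nu>"
proof -
  have pow: "(\<lambda>n. 2 * S ^ n * V) \<longlonglongrightarrow> 0" for V
    using LIMSEQ_power_zero[of S] S_nonneg S1 by (intro tendsto_mult_left_zero tendsto_mult_right_zero) auto
  define \<mu> :: "'d config measure" where "\<mu> = pca_kernel r (\<lambda>_. 1)"
  have \<mu>: "\<mu> \<in> prob_measures_on_Omega"
    unfolding \<mu>_def by (rule pca_kernel_in[OF pca one_in_Omega_S])
  define \<mu>s where "\<mu>s n = (pca_push r ^^ n) \<mu>" for n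
  have \<mu>s: "\<mu>s n \<in> prob_measures_on_Omega" for n
    unfolding \<mu>s_def by (rule pca_push_iterate_in[OF \<mu>])
  have conv: "convergent (\<lambda>n. integral\<^sup>L (\<mu>s n) f)" if f: "finite \<Lambda>" "depends_on \<Lambda> f" for \<Lambda> f
  proof -
    let ?V = "\<Sum>x\<in>\<Lambda>. osc x f"
    have V: "0 \<le> ?V" by (intro sum_nonneg osc_nonneg depends_on_continuous_on[OF f])
    \<comment> \<open>The orbit at time \<open>n + k\<close> is n steps started from its own state
      at time k, so the bound does not depend on k.\<close>
    have bound: "\<bar>integral\<^sup>L (\<mu>s n) f - integral\<^sup>L (\<mu>s (n + k)) f\<bar> \<le> 2 * S ^ n * ?V" for n k
      unfolding \<mu>s_def funpow_add comp_apply
      by (rule osc_closeD[OF osc_close_pca_push_iterate[OF \<mu> pca_push_iterate_in[OF \<mu>]] f])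
    have "Cauchy (\<lambda>n. integral\<^sup>L (\<mu>s n) f)"
    proof (rule metric_CauchyI)
      fix e :: real assume "e > 0"
      then obtain N where "\<And>n. n \<ge> N \<Longrightarrow> norm (2 * S ^ n * ?V - 0) < e / 2"
        using LIMSEQ_D[OF pow, of "e / 2"] by (metis half_gt_zero)
      hence N: "2 * S ^ N * ?V < e / 2" using V S_nonneg by force
      have "dist (integral\<^sup>L (\<mu>s m) f) (integral\<^sup>L (\<mu>s n) f) < e" if "m \<ge> N" "n \<ge> N" for m n
        using bound[of N "m - N"] bound[of N "n - N"] N that by (simp add: dist_real_def)
      thus "\<exists>M. \<forall>m\<ge>M. \<forall>n\<ge>M. dist (integral\<^sup>L (\<mu>s m) f) (integral\<^sup>L (\<mu>s n) f) < e" by blast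
    qed
    thus ?thesis by (rule Cauchy_convergent)
  qed
  obtain \<nu> where \<nu>: "\<nu> \<in> prob_measures_on_Omega"
    and lim: "\<And>\<Lambda> f. finite \<Lambda> \<Longrightarrow> depends_on \<Lambda> f \<Longrightarrow> (\<lambda>n. integral\<^sup>L (\<mu>s n) f) \<longlonglongrightarrow> integral\<^sup>L \<nu> f"
  proof -
    have "\<exists>\<nu>\<in>prob_measures_on_Omega. \<forall>\<Lambda> f. finite \<Lambda> \<longrightarrow> depends_on \<Lambda> f \<longrightarrow>
      (\<lambda>n. integral\<^sup>L (\<mu>s n) f) \<longlonglongrightarrow> integral\<^sup>L \<nu> f"
      by (rule limit_measure_exists[OF \<mu>s]) (rule conv)
    thus thesis using that by auto
  qed
  have weak: "weakly_converges \<mu>s \<nu>" by (rule weakly_convergesI_local[OF \<mu>s \<nu> lim])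

  \<comment> \<open>The integrals at time \<open>Suc n\<close> are read in two ways: as a shifted
    sequence, and as integrals of the continuous function \<open>pca_op r f\<close> at time
    n.\<close>
  have push_eq: "integral\<^sup>L (pca_push r \<nu>) f = integral\<^sup>L \<nu> f"
    if f: "finite \<Lambda>" "depends_on \<Lambda> f" for \<Lambda> f
  proof (rule LIMSEQ_unique)
    note cont = depends_on_continuous_on[OF f]
    show "(\<lambda>n. integral\<^sup>L (\<mu>s (Suc n)) f) \<longlonglongrightarrow> integral\<^sup>L \<nu> f"
      using LIMSEQ_Suc[OF lim[OF f]] .
    have "(\<lambda>n. integral\<^sup>L (\<mu>s n) (pca_op r f)) \<longlonglongrightarrow> integral\<^sup>L \<nu> (pca_op r f)"
      by (rule weakly_convergesD[OF weak continuous_on_pca_op[OF pca f]])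
    thus "(\<lambda>n. integral\<^sup>L (\<mu>s (Suc n)) f) \<longlonglongrightarrow> integral\<^sup>L (pca_push r \<nu>) f"
      using integral_pca_push[OF pca \<mu>s cont] integral_pca_push[OF pca \<nu> cont] by (simp add: \<mu>s_def)
  qed
  have stat: "pca_push r \<nu> = \<nu>"
    by (rule measure_eqI_local[OF pca_push_in[OF pca \<nu>] \<nu> push_eq[OF _ depends_on_prod]])
  have stat_iter: "(pca_push r ^^ n) \<nu> = \<nu>" for n by (induction n) (simp_all add: stat)
  have weak_all: "weakly_converges (\<lambda>n. (pca_push r ^^ n) \<rho>) \<nu>"
    if \<rho>: "\<rho> \<in> prob_measures_on_Omega" for \<rho>
  proof (rule weakly_convergesI_local[OF pca_push_iterate_in[OF \<rho>] \<nu>])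
    fix \<Lambda> and f :: "'d config \<Rightarrow> real" assume f: "finite \<Lambda>" "depends_on \<Lambda> f"
    have "\<bar>integral\<^sup>L ((pca_push r ^^ n) \<rho>) f - integral\<^sup>L \<nu> f\<bar> \<le> 2 * S ^ n * (\<Sum>x\<in>\<Lambda>. osc x f)" for n
      using osc_closeD[OF osc_close_pca_push_iterate[OF \<rho> \<nu>] f, of n] by (simp add: stat_iter)
    hence "(\<lambda>n. integral\<^sup>L ((pca_push r ^^ n) \<rho>) f - integral\<^sup>L \<nu> f) \<longlonglongrightarrow> 0"
      by (intro Lim_null_comparison[OF always_eventually pow]) auto
    thus "(\<lambda>n. integral\<^sup>L ((pca_push r ^^ n) \<rho>) f) \<longlonglongrightarrow> integral\<^sup>L \<nu> f"
      by (simp add: LIM_zero_iff)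
  qed
  have "\<rho> = \<nu>" if "stationary r \<rho>" for \<rho>
  proof -
    have \<rho>: "\<rho> \<in> prob_measures_on_Omega" and "pca_push r \<rho> = \<rho>"
      using that by (auto simp: stationary_def)
    hence iter: "(pca_push r ^^ n) \<rho> = \<rho>" for n by (induction n) simp_all
    show ?thesis
    proof (rule measure_eqI_local[OF \<rho> \<nu>])
      fix J :: "(int ^ 'd) set" and g :: "int ^ 'd \<Rightarrow> real \<Rightarrow> real" assume J: "finite J"
      have "(\<lambda>n. \<integral>\<sigma>. (\<Prod>x\<in>J. g x (\<sigma> x)) \<partial>\<rho>) \<longlonglongrightarrow> (\<integral>\<sigma>. (\<Prod>x\<in>J. g x (\<sigma> x)) \<partial>\<nu>)"
        using weakly_convergesD[OF weak_all[OF \<rho>] depends_on_continuous_on[OF J depends_on_prod]]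
        by (simp add: iter)
      thus "(\<integral>\<sigma>. (\<Prod>x\<in>J. g x (\<sigma> x)) \<partial>\<rho>) = (\<integral>\<sigma>. (\<Prod>x\<in>J. g x (\<sigma> x)) \<partial>\<nu>)"
        by (simp add: LIMSEQ_const_iff)
    qed
  qed
  moreover have "stationary r \<nu>" using \<nu> stat by (simp add: stationary_def)
  ultimately have "unique_stationary r \<nu>" unfolding unique_stationary_def by blast
  with weak_all show thesis by (intro that)
qed

end

section \<open>Non-interacting automata\<close>

lemma integral_PiM_prod:
  fixes M :: "int ^ 'd::finite \<Rightarrow> real measure" and g :: "int ^ 'd \<Rightarrow> real \<Rightarrow> real"
  assumes M: "\<And>x. prob_space (M x)" "\<And>x. sets (M x) = sets (count_space {-1, 1})"
    and J: "finite J"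
  shows "(\<integral>\<sigma>. (\<Prod>x\<in>J. g x (\<sigma> x)) \<partial>PiM UNIV M)
    = (\<Prod>x\<in>J. measure (M x) {1} * g x 1 + (1 - measure (M x) {1}) * g x (-1))"
  using J
proof (induction J rule: finite_induct)
  case empty
  interpret prob_space "PiM UNIV M" using M(1) by (intro prob_space_PiM)
  show ?case by (simp add: prob_space)
next
  case (insert x J)
  let ?m = "\<lambda>x. measure (M x) {1} * g x 1 + (1 - measure (M x) {1}) * g x (-1)"
  have fin: "finite (insert x J)" using insert.hyps by simp
  have upd: "(\<Prod>y\<in>J. g y ((\<sigma>(x := s)) y)) = (\<Prod>y\<in>J. g y (\<sigma> y))" for \<sigma> s
    using insert.hyps by (intro prod.cong) auto
  have "(\<integral>\<sigma>. (\<Prod>y\<in>insert x J. g y (\<sigma> y)) \<partial>PiM UNIV M)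
      = (\<integral>\<sigma>. avg1 (\<lambda>x. measure (M x) {1}) x (\<lambda>\<sigma>. \<Prod>y\<in>insert x J. g y (\<sigma> y)) \<sigma> \<partial>PiM UNIV M)"
    by (rule integral_PiM_avg1[OF M fin depends_on_prod])
  also have "\<dots> = (\<integral>\<sigma>. ?m x * (\<Prod>y\<in>J. g y (\<sigma> y)) \<partial>PiM UNIV M)"
    using insert.hyps upd by (simp add: avg1_def algebra_simps)
  also have "\<dots> = ?m x * (\<Prod>y\<in>J. ?m y)"
    by (simp add: insert.IH)
  finally show ?case using insert.hyps by simp
qed

text \<open>The mean of a stationary law of a two-state chain whose next spin has mean
  \<open>a\<close> from +1 and \<open>b\<close> from -1. The equation is affine in m; it degenerates
  only for \<open>a = 1\<close>, \<open>b = -1\<close>, where the chain never moves and any m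
  works.\<close>

lemma stationary_mean_exists:
  fixes a b :: real
  assumes "\<bar>a\<bar> \<le> 1" "\<bar>b\<bar> \<le> 1"
  shows "\<exists>m. \<bar>m\<bar> \<le> 1 \<and> m = (1 + m) / 2 * a + (1 - m) / 2 * b"
proof (cases "2 - a + b = 0")
  case True
  hence "a = 1" "b = -1" using assms by (auto simp: abs_le_iff)
  thus ?thesis by (intro exI[of _ 0]) auto
next
  case False
  hence pos: "2 - a + b > 0" using assms by (auto simp: abs_le_iff)
  define m where "m = (a + b) / (2 - a + b)"
  have m: "m * (2 - a + b) = a + b" using pos by (simp add: m_def)
  have "m = (1 + m) / 2 * a + (1 - m) / 2 * b"
    using m by (simp add: field_simps)
  moreover have "\<bar>m\<bar> \<le> 1"
    using pos assms by (auto simp: m_def abs_le_iff field_simps)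
  ultimately show ?thesis by blast
qed

lemma non_interactingD:
  "non_interacting r \<Longrightarrow> \<sigma> \<in> Omega_S \<Longrightarrow> \<sigma>' \<in> Omega_S \<Longrightarrow> \<sigma> x = \<sigma>' x \<Longrightarrow> pca_h r x \<sigma> = pca_h r x \<sigma>'"
  unfolding non_interacting_def by blast

context
  fixes r :: "(int ^ 'd::finite) set \<Rightarrow> real"
  assumes pca: "pca r" and non_int: "non_interacting r"
begin

text \<open>Without interaction the sites run independent two-state chains, so the product of
  one-site stationary laws is stationary.\<close>

lemma product_stationary_exists: "\<exists>\<pi>. product_measure \<pi> \<and> stationary r \<pi>"
proof -
  define hp hm where "hp x = pca_h r x (\<lambda>_. 1)" and "hm x = pca_h r x ((\<lambda>_. 1)(x := -1))" for x
  have in_Omega: "(\<lambda>_. 1)(x := -1) \<in> Omega_S" for x :: "int ^ 'd"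
    by (rule Omega_S_upd[OF one_in_Omega_S]) simp
  have h: "pca_h r x \<eta> = (if \<eta> x = 1 then hp x else hm x)" if "\<eta> \<in> Omega_S" for \<eta> x
  proof (cases "\<eta> x = 1")
    case True
    hence "pca_h r x \<eta> = pca_h r x (\<lambda>_. 1)"
      by (intro non_interactingD[OF non_int that one_in_Omega_S])
    thus ?thesis using True by (simp add: hp_def)
  next
    case False
    hence "\<eta> x = ((\<lambda>_. 1)(x := -1)) x" using Omega_S_cases[OF that, of x] by simp
    hence "pca_h r x \<eta> = pca_h r x ((\<lambda>_. 1)(x := -1))"
      by (rule non_interactingD[OF non_int that in_Omega])
    thus ?thesis using False by (simp add: hm_def)
  qed
  have "\<exists>m. \<bar>m\<bar> \<le> 1 \<and> m = (1 + m) / 2 * hp x + (1 - m) / 2 * hm x" for x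
    unfolding hp_def hm_def
    by (rule stationary_mean_exists[OF abs_pca_h_le[OF pca one_in_Omega_S] abs_pca_h_le[OF pca in_Omega]])
  then obtain m where m: "\<And>x. \<bar>m x\<bar> \<le> 1" "\<And>x. m x = (1 + m x) / 2 * hp x + (1 - m x) / 2 * hm x"
    by metis
  define \<pi> where "\<pi> = PiM UNIV (\<lambda>x. spin_measure (m x))"
  note M = prob_space_spin_measure[OF m(1)] sets_spin_measure
  have \<pi>: "\<pi> \<in> prob_measures_on_Omega"
    unfolding \<pi>_def by (rule PiM_in_prob_measures[OF M])
  have "pca_push r \<pi> = \<pi>"
  proof (rule measure_eqI_local[OF pca_push_in[OF pca \<pi>] \<pi>])
    fix J :: "(int ^ 'd) set" and g :: "int ^ 'd \<Rightarrow> real \<Rightarrow> real" assume J: "finite J"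
    \<comment> \<open>\<open>q x s\<close> is the chance of +1 at \<open>x\<close> after one step
      from spin \<open>s\<close>, and \<open>G x\<close> is the one-site transition applied to
      \<open>g x\<close>; the kernel thus maps product functions to product functions.\<close>
    define q where "q x s = (1 + (if s = 1 then hp x else hm x)) / 2" for x and s :: real
    define G where "G x s = q x s * g x 1 + (1 - q x s) * g x (-1)" for x s
    have "pca_op r (\<lambda>\<sigma>. \<Prod>x\<in>J. g x (\<sigma> x)) \<eta> = (\<Prod>x\<in>J. G x (\<eta> x))" if "\<eta> \<in> Omega_S" for \<eta>
    proof -
      note le = abs_pca_h_le[OF pca that]
      show ?thesis
        unfolding pca_op_def pca_kernel_eq[OF pca that]
          integral_PiM_prod[OF prob_space_spin_measure[OF le] sets_spin_measure J, where g = g]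
        by (simp only: measure_spin_measure[OF le]) (simp only: h[OF that] G_def q_def)
    qed
    hence "(\<integral>\<sigma>. (\<Prod>x\<in>J. g x (\<sigma> x)) \<partial>pca_push r \<pi>) = (\<integral>\<eta>. (\<Prod>x\<in>J. G x (\<eta> x)) \<partial>\<pi>)"
      unfolding integral_pca_push[OF pca \<pi> depends_on_continuous_on[OF J depends_on_prod]]
      using prob_measures_on_OmegaD(3)[OF \<pi>]
      by (intro Bochner_Integration.integral_cong) auto
    also have "\<dots> = (\<Prod>x\<in>J. (1 + m x) / 2 * G x 1 + (1 - (1 + m x) / 2) * G x (-1))"
      unfolding \<pi>_def integral_PiM_prod[OF M J, where g = G] by (simp only: measure_spin_measure[OF m(1)])
    also have "\<dots> = (\<Prod>x\<in>J. (1 + m x) / 2 * g x 1 + (1 - (1 + m x) / 2) * g x (-1))"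
    proof (rule prod.cong[OF refl])
      fix x
      \<comment> \<open>Collecting the coefficient of \<open>g x 1\<close> exhibits the new mean,
        which the fixed-point equation \<open>m(2)\<close> turns back into
        \<open>m x\<close>.\<close>
      have "(1 + m x) / 2 * G x 1 + (1 - (1 + m x) / 2) * G x (-1)
          = (1 + ((1 + m x) / 2 * hp x + (1 - m x) / 2 * hm x)) / 2 * g x 1
            + (1 - (1 + ((1 + m x) / 2 * hp x + (1 - m x) / 2 * hm x)) / 2) * g x (-1)"
        by (simp add: G_def q_def field_simps)
      also have "\<dots> = (1 + m x) / 2 * g x 1 + (1 - (1 + m x) / 2) * g x (-1)"
        by (simp only: m(2)[symmetric])
      finally show "(1 + m x) / 2 * G x 1 + (1 - (1 + m x) / 2) * G x (-1)
          = (1 + m x) / 2 * g x 1 + (1 - (1 + m x) / 2) * g x (-1)" .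
    qed
    also have "\<dots> = (\<integral>\<sigma>. (\<Prod>x\<in>J. g x (\<sigma> x)) \<partial>\<pi>)"
      unfolding \<pi>_def integral_PiM_prod[OF M J, where g = g] by (simp only: measure_spin_measure[OF m(1)])
    finally show "(\<integral>\<sigma>. (\<Prod>x\<in>J. g x (\<sigma> x)) \<partial>pca_push r \<pi>) = (\<integral>\<sigma>. (\<Prod>x\<in>J. g x (\<sigma> x)) \<partial>\<pi>)" .
  qed
  moreover have "product_measure \<pi>"
    unfolding product_measure_def \<pi>_def
    by (intro exI[of _ "\<lambda>x. spin_measure (m x)"] conjI allI M refl)
  ultimately show ?thesis using \<pi> by (auto simp: stationary_def)
qed

end

section \<open>Walsh coefficients of the field at the origin\<close>

abbreviation uniform_config :: "'d::finite config measure" where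
  "uniform_config \<equiv> PiM UNIV (\<lambda>_. spin_measure 0)"

lemma measure_spin_measure_0: "measure (spin_measure 0) {1} = 1 / 2"
  by (subst measure_spin_measure) auto

lemma uniform_config_in: "uniform_config \<in> prob_measures_on_Omega"
  by (intro PiM_in_prob_measures prob_space_spin_measure sets_spin_measure) simp

text \<open>A site in both sets contributes the square of a spin, which is 1; a site in exactly one
  of them averages to 0 under the fair coin.\<close>

lemma Walsh_orthonormal:
  fixes A B :: "(int ^ 'd::finite) set"
  assumes "finite A" "finite B"
  shows "(\<integral>\<eta>. (\<Prod>y\<in>A. \<eta> y) * (\<Prod>y\<in>B. \<eta> y) \<partial>uniform_config) = of_bool (A = B)"
proof -
  define g :: "int ^ 'd \<Rightarrow> real \<Rightarrow> real"
    where "g y s = (if y \<in> A then s else 1) * (if y \<in> B then s else 1)" for y s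
  have "(\<Prod>y\<in>A. \<eta> y) * (\<Prod>y\<in>B. \<eta> y) = (\<Prod>y\<in>A \<union> B. g y (\<eta> y))" for \<eta> :: "'d config"
  proof -
    have "(\<Prod>y\<in>A. \<eta> y) = (\<Prod>y\<in>A \<union> B. if y \<in> A then \<eta> y else 1)"
      "(\<Prod>y\<in>B. \<eta> y) = (\<Prod>y\<in>A \<union> B. if y \<in> B then \<eta> y else 1)"
      using assms by (auto intro!: prod.mono_neutral_cong_left)
    thus ?thesis by (simp add: g_def prod.distrib)
  qed
  hence "(\<integral>\<eta>. (\<Prod>y\<in>A. \<eta> y) * (\<Prod>y\<in>B. \<eta> y) \<partial>uniform_config)
      = (\<Prod>y\<in>A \<union> B. 1 / 2 * g y 1 + (1 - 1 / 2) * g y (-1))"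
    using assms prob_space_spin_measure[of 0]
    by (simp only:) (subst integral_PiM_prod; simp add: sets_spin_measure measure_spin_measure_0)
  also have "\<dots> = (\<Prod>y\<in>A \<union> B. of_bool (y \<in> A \<longleftrightarrow> y \<in> B))"
    by (intro prod.cong) (auto simp: g_def)
  also have "\<dots> = of_bool (A = B)"
  proof (cases "A = B")
    case False
    then obtain y where "y \<in> A \<union> B" "\<not> (y \<in> A \<longleftrightarrow> y \<in> B)" by blast
    thus ?thesis using False assms by (subst prod_zero) auto
  qed simp
  finally show ?thesis .
qed

text \<open>At \<open>x = 0\<close> the translation is trivial, so the field is a Walsh series and
  \<open>r B\<close> is its coefficient. Uniform convergence lets a finite partial sum replace the
  series up to any \<open>e\<close>.\<close>

lemma pca_coefficient_eq:
  fixes r :: "(int ^ 'd::finite) set \<Rightarrow> real"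
  assumes pca: "pca r" and B: "finite B"
  shows "r B = (\<integral>\<eta>. pca_h r 0 \<eta> * (\<Prod>y\<in>B. \<eta> y) \<partial>uniform_config)" (is "_ = ?I")
proof -
  let ?U = "uniform_config :: 'd config measure"
  let ?w = "\<lambda>A (\<eta> :: 'd config). \<Prod>y\<in>A. \<eta> y"
  let ?F = "finite_subsets_at_top {A :: (int ^ 'd) set. finite A}"
  have cont_w: "continuous_on Omega_S (?w A)" if "finite A" for A
    using depends_on_continuous_on[OF that depends_on_prod[of A "\<lambda>_ s. s"]] .
  have bound: "\<bar>r B - ?I\<bar> \<le> e" if "e > 0" for e
  proof -
    have "\<forall>\<^sub>F F in ?F. \<forall>\<eta>\<in>Omega_S. dist (\<Sum>A\<in>F. r A * ?w ((\<lambda>a. a + 0) ` A) \<eta>) (pca_h r 0 \<eta>) < e"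
      by (rule uniform_limitD[OF uniform_limit_pca_h[OF pca] that])
    \<comment> \<open>The partial sum has to contain \<open>B\<close> already: otherwise
      orthogonality would return 0 in place of \<open>r B\<close>.\<close>
    moreover have "\<forall>\<^sub>F F in ?F. finite F \<and> {B} \<subseteq> F \<and> F \<subseteq> {A. finite A}"
      unfolding eventually_finite_subsets_at_top using B by (intro exI[of _ "{B}"]) auto
    ultimately have "\<exists>F. (\<forall>\<eta>\<in>Omega_S. dist (\<Sum>A\<in>F. r A * ?w ((\<lambda>a. a + 0) ` A) \<eta>) (pca_h r 0 \<eta>) < e)
        \<and> finite F \<and> {B} \<subseteq> F \<and> F \<subseteq> {A. finite A}"
      by (rule eventually_happens'[OF finite_subsets_at_top_neq_bot eventually_conj])
    then obtain F where F: "finite F" "B \<in> F" "\<And>A. A \<in> F \<Longrightarrow> finite A"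
      and close: "\<And>\<eta>. \<eta> \<in> Omega_S \<Longrightarrow> \<bar>(\<Sum>A\<in>F. r A * ?w A \<eta>) - pca_h r 0 \<eta>\<bar> < e"
      by (auto simp: dist_real_def)
    have int: "integrable ?U (\<lambda>\<eta>. ?w A \<eta> * ?w B \<eta>)" if "A \<in> F" for A
      by (intro continuous_on_integrable[OF uniform_config_in] continuous_intros cont_w F that B)
    have "(\<integral>\<eta>. (\<Sum>A\<in>F. r A * ?w A \<eta>) * ?w B \<eta> \<partial>?U) = (\<Sum>A\<in>F. r A * (\<integral>\<eta>. ?w A \<eta> * ?w B \<eta> \<partial>?U))"
      using int by (simp add: sum_distrib_right mult.assoc)
    also have "\<dots> = (\<Sum>A\<in>F. if A = B then r A else 0)"
      using F B by (intro sum.cong) (auto simp: Walsh_orthonormal)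
    also have "\<dots> = r B" using F by simp
    finally have rB: "(\<integral>\<eta>. (\<Sum>A\<in>F. r A * ?w A \<eta>) * ?w B \<eta> \<partial>?U) = r B" .
    show "\<bar>r B - ?I\<bar> \<le> e"
      unfolding rB[symmetric]
    proof (rule abs_integral_diff_le[OF uniform_config_in])
      show "continuous_on Omega_S (\<lambda>\<eta>. (\<Sum>A\<in>F. r A * ?w A \<eta>) * ?w B \<eta>)"
        by (intro continuous_intros cont_w F B)
      show "continuous_on Omega_S (\<lambda>\<eta>. pca_h r 0 \<eta> * ?w B \<eta>)"
        by (intro continuous_intros continuous_on_pca_h[OF pca] cont_w B)
      fix \<eta> :: "'d config" assume \<eta>: "\<eta> \<in> Omega_S"
      have "\<bar>(\<Sum>A\<in>F. r A * ?w A \<eta>) * ?w B \<eta> - pca_h r 0 \<eta> * ?w B \<eta>\<bar>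
          = \<bar>(\<Sum>A\<in>F. r A * ?w A \<eta>) - pca_h r 0 \<eta>\<bar> * \<bar>?w B \<eta>\<bar>"
        by (simp only: left_diff_distrib[symmetric] abs_mult)
      also have "\<dots> \<le> e" using close[OF \<eta>] by (simp add: abs_prod_Omega_S[OF \<eta>])
      finally show "\<bar>(\<Sum>A\<in>F. r A * ?w A \<eta>) * ?w B \<eta> - pca_h r 0 \<eta> * ?w B \<eta>\<bar> \<le> e" .
    qed
  qed
  have "\<bar>r B - ?I\<bar> \<le> 0"
    by (rule field_le_epsilon) (use bound in simp)
  thus ?thesis by simp
qed

lemma abs_pca_coefficient_le:
  fixes r :: "(int ^ 'd::finite) set \<Rightarrow> real"
  assumes pca: "pca r" and B: "finite B"
  shows "\<bar>r B\<bar> \<le> 1"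
proof -
  have "\<bar>(\<integral>\<eta>. pca_h r 0 \<eta> * (\<Prod>y\<in>B. \<eta> y) \<partial>uniform_config) - (\<integral>\<eta>. 0 \<partial>(uniform_config :: 'd config measure))\<bar> \<le> 1"
  proof (rule abs_integral_diff_le[OF uniform_config_in])
    show "continuous_on Omega_S (\<lambda>\<eta>. pca_h r 0 \<eta> * (\<Prod>y\<in>B. \<eta> y))"
      by (intro continuous_intros continuous_on_pca_h[OF pca]
            depends_on_continuous_on[OF B depends_on_prod[of B "\<lambda>_ s. s"]])
  qed (auto simp: abs_mult abs_prod_Omega_S abs_pca_h_le[OF pca])
  thus ?thesis by (simp add: pca_coefficient_eq[OF assms])
qed

text \<open>Flipping the spin at \<open>y\<close> leaves the field at the origin alone and reverses
  the Walsh function, so averaging over that spin annihilates the integrand.\<close>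

lemma non_interacting_coefficient_eq_0:
  fixes r :: "(int ^ 'd::finite) set \<Rightarrow> real"
  assumes pca: "pca r" and ni: "non_interacting r" and B: "finite B" and y: "y \<in> B" "y \<noteq> 0"
  shows "r B = 0"
proof -
  let ?f = "\<lambda>\<eta>. pca_h r 0 \<eta> * (\<Prod>z\<in>B. \<eta> z)"
  have dep: "depends_on (insert 0 B) ?f"
    unfolding depends_on_def
  proof (intro ballI impI)
    fix \<sigma> \<sigma>' :: "'d config" assume \<sigma>: "\<sigma> \<in> Omega_S" "\<sigma>' \<in> Omega_S" "\<forall>x\<in>insert 0 B. \<sigma> x = \<sigma>' x"
    hence "pca_h r 0 \<sigma> = pca_h r 0 \<sigma>'"
      by (intro non_interactingD[OF ni]) auto
    thus "?f \<sigma> = ?f \<sigma>'" using \<sigma>(3) by simp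
  qed
  have zero: "avg1 (\<lambda>_. measure (spin_measure 0) {1}) y ?f \<eta> = 0" if \<eta>: "\<eta> \<in> Omega_S" for \<eta>
  proof -
    have "pca_h r 0 (\<eta>(y := 1)) = pca_h r 0 (\<eta>(y := -1))"
      using y(2) by (intro non_interactingD[OF ni Omega_S_upd[OF \<eta>] Omega_S_upd[OF \<eta>]]) auto
    moreover have "(\<Prod>z\<in>B. (\<eta>(y := s)) z) = s * (\<Prod>z\<in>B - {y}. \<eta> z)" for s
      using B y by (subst prod.remove[of B y]) (auto intro!: prod.cong)
    ultimately show ?thesis
      unfolding avg1_def measure_spin_measure_0 by (simp only:) simp
  qed
  have "r B = integral\<^sup>L uniform_config ?f" by (rule pca_coefficient_eq[OF pca B])
  also have "\<dots> = integral\<^sup>L uniform_config (avg1 (\<lambda>_. measure (spin_measure 0) {1}) y ?f)"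
    using B by (intro integral_PiM_avg1[OF prob_space_spin_measure sets_spin_measure _ dep]) auto
  also have "\<dots> = (\<integral>\<eta>. 0 \<partial>(uniform_config :: 'd config measure))"
    by (intro Bochner_Integration.integral_cong refl zero)
       (simp add: prob_measures_on_OmegaD(3)[OF uniform_config_in])
  finally show ?thesis by simp
qed

text \<open>Only \<open>{}\<close> and \<open>{0}\<close> can carry a coefficient, and
  \<open>{}\<close> has weight 0.\<close>

lemma non_interacting_total_influence_le:
  fixes r :: "(int ^ 'd::finite) set \<Rightarrow> real"
  assumes pca: "pca r" and ni: "non_interacting r"
  shows "(\<Sum>\<^sub>\<infinity>A\<in>{A. finite A}. real (card A) * \<bar>r A\<bar>) \<le> 1"
proof -
  have "(\<Sum>\<^sub>\<infinity>A\<in>{A. finite A}. real (card A) * \<bar>r A\<bar>) = (\<Sum>\<^sub>\<infinity>A\<in>{{0}}. real (card A) * \<bar>r A\<bar>)"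
  proof (rule infsum_cong_neutral)
    fix A :: "(int ^ 'd) set" assume A: "A \<in> {A. finite A} - {{0}}"
    show "real (card A) * \<bar>r A\<bar> = 0"
    proof (cases "A = {}")
      case False
      with A obtain y where "y \<in> A" "y \<noteq> 0" by blast
      thus ?thesis using non_interacting_coefficient_eq_0[OF pca ni] A by simp
    qed simp
  qed auto
  thus ?thesis using abs_pca_coefficient_le[OF pca, of "{0}"] by simp
qed

text \<open>In the non-interacting case \<kappa> = 1 means \<open>\<bar>r {0}\<bar> = 1\<close>; the
  bound on the field then forces \<open>r {} = 0\<close>, so each step copies every spin or flips
  every spin. Both maps have many stationary measures, hence existence of a unique one is claimed
  for \<kappa> different from 1.\<close>

theorem theorem3p1:
  fixes r :: "(int ^ 'd::finite) set \<Rightarrow> real"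
    and \<mu> :: "(int ^ 'd \<Rightarrow> real) measure"
    and \<kappa> C c :: real
  assumes "pca r"
    and "(\<lambda>A. real (card A) * \<bar>r A\<bar>) summable_on {A. finite A}"
    and "\<kappa> = (\<Sum>\<^sub>\<infinity>A\<in>{A. finite A}. real (card A) * \<bar>r A\<bar>)\<^sup>2"
    and "C > 0"
    and "GCB C \<mu>"
    and "\<forall>\<pi> :: (int ^ 'd \<Rightarrow> real) measure. product_measure \<pi> \<longrightarrow> GCB c \<pi>"
  shows
    "(\<forall>\<pi> :: (int ^ 'd \<Rightarrow> real) measure. product_measure \<pi> \<longrightarrow> GCB (1/4) \<pi>) \<and>
     GCB (c + C * \<kappa>) (pca_push r \<mu>) \<and>
     (\<forall>n. GCB (if \<kappa> \<noteq> 1 then c * ((1 - \<kappa> ^ n) / (1 - \<kappa>)) + C * \<kappa> ^ n else c * real n + C)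
              ((pca_push r ^^ n) \<mu>)) \<and>
     (\<kappa> < 1 \<longrightarrow>
        (\<exists>\<nu>. unique_stationary r \<nu> \<and>
             weakly_converges (\<lambda>n. (pca_push r ^^ n) \<mu>) \<nu> \<and>
             GCB (c / (1 - \<kappa>)) \<nu>)) \<and>
     (non_interacting r \<longrightarrow>
        (\<forall>\<mu>'. satisfies_GCB \<mu>' \<longrightarrow> (\<forall>n. satisfies_GCB ((pca_push r ^^ n) \<mu>'))) \<and>
        (\<kappa> \<noteq> 1 \<longrightarrow> (\<exists>\<nu>. unique_stationary r \<nu>)) \<and>
        (\<forall>\<nu>. unique_stationary r \<nu> \<longrightarrow> product_measure \<nu> \<and> satisfies_GCB \<nu>))"
proof -
  note pca = \<open>pca r\<close>
  define S where "S = (\<Sum>\<^sub>\<infinity>A\<in>{A. finite A}. real (card A) * \<bar>r A\<bar>)"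
  have \<kappa>: "\<kappa> = S\<^sup>2" using assms(3) by (simp add: S_def)
  have S: "sum (influence r) Z \<le> S" if "finite Z" for Z
    unfolding S_def by (rule sum_influence_le[OF pca assms(2) that])
  have S0: "0 \<le> S" using S[of "{}"] by simp
  have c: "GCB c \<pi>" if "product_measure \<pi>" for \<pi> :: "'d config measure"
    using assms(6) that by blast
  have \<mu>: "\<mu> \<in> prob_measures_on_Omega" using \<open>GCB C \<mu>\<close> by (simp add: GCB_def)
  have iter: "GCB (c * (\<Sum>k<n. \<kappa> ^ k) + C' * \<kappa> ^ n) ((pca_push r ^^ n) \<mu>')" if "GCB C' \<mu>'" for C' \<mu>' n
    unfolding \<kappa> by (rule GCB_pca_push_iterate[OF pca S c that])
  have a: "GCB (c + C * \<kappa>) (pca_push r \<mu>)"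
    unfolding \<kappa> by (rule GCB_pca_push[OF pca S c \<open>GCB C \<mu>\<close>])
  have b: "GCB (if \<kappa> \<noteq> 1 then c * ((1 - \<kappa> ^ n) / (1 - \<kappa>)) + C * \<kappa> ^ n else c * real n + C)
              ((pca_push r ^^ n) \<mu>)" for n
    using iter[OF \<open>GCB C \<mu>\<close>, of n] by (cases "\<kappa> = 1") (simp_all add: sum_gp_strict)
  have ergodic: "\<exists>\<nu>. unique_stationary r \<nu> \<and> weakly_converges (\<lambda>n. (pca_push r ^^ n) \<mu>) \<nu> \<and>
      GCB (c / (1 - \<kappa>)) \<nu>" if "\<kappa> < 1"
  proof -
    have "S < 1" using that S0 unfolding \<kappa> by (simp add: power2_less_1_iff)
    then obtain \<nu> where \<nu>: "unique_stationary r \<nu>"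
      "weakly_converges (\<lambda>n. (pca_push r ^^ n) \<mu>) \<nu>"
      using pca_ergodic[OF pca S] \<mu> by metis
    have "norm \<kappa> < 1" using that by (simp add: \<kappa>)
    have "(\<lambda>n. \<Sum>k<n. \<kappa> ^ k) \<longlonglongrightarrow> 1 / (1 - \<kappa>)"
      using geometric_sums[OF \<open>norm \<kappa> < 1\<close>] by (simp add: sums_def)
    \<comment> \<open>The term with \<open>C\<close> vanishes in the limit, so the constant for
      \<open>\<nu>\<close> keeps no memory of the initial measure.\<close>
    hence "(\<lambda>n. c * (\<Sum>k<n. \<kappa> ^ k) + C * \<kappa> ^ n) \<longlonglongrightarrow> c * (1 / (1 - \<kappa>)) + C * 0"
      by (intro tendsto_intros LIMSEQ_power_zero \<open>norm \<kappa> < 1\<close>)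
    from GCB_limit[OF iter[OF \<open>GCB C \<mu>\<close>] this _ \<nu>(2)] \<nu>(1)
    have "GCB (c / (1 - \<kappa>)) \<nu>" by (simp add: unique_stationary_def stationary_def)
    with \<nu> show ?thesis by blast
  qed
  have conserved: "satisfies_GCB ((pca_push r ^^ n) \<mu>')" if "satisfies_GCB \<mu>'" for \<mu>' n
    using that iter unfolding satisfies_GCB_def by blast
  have exists: "\<exists>\<nu>. unique_stationary r \<nu>" if "non_interacting r" "\<kappa> \<noteq> 1"
  proof -
    have "S \<le> 1" unfolding S_def by (rule non_interacting_total_influence_le[OF pca that(1)])
    hence "\<kappa> \<le> 1" unfolding \<kappa> using S0 by (rule power_le_one[rotated])
    thus ?thesis using ergodic that(2) by auto
  qed
  have product: "product_measure \<nu> \<and> satisfies_GCB \<nu>" if ni: "non_interacting r" and \<nu>: "unique_stationary r \<nu>" for \<nu>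
  proof -
    obtain \<pi> where "product_measure \<pi>" "stationary r \<pi>"
      using product_stationary_exists[OF pca ni] by blast
    hence "product_measure \<nu>" using \<nu> unfolding unique_stationary_def by blast
    thus ?thesis using c unfolding satisfies_GCB_def by blast
  qed
  show ?thesis
    using product_measure_GCB a b ergodic conserved exists product by blast
qed

end
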